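(* Suppose the prior $\Pi$ has the Kullback–Leibler property, i.e. $\Pi(\{f : D(f,f_0)<\varepsilon\})>0$ for every $\varepsilon>0$. Let $A\subseteq\Omega$ be a (measurable) set of densities, let $L_n=\int_A R_n(f)\,\Pi(df)$, and suppose that $$\sum_{n\ge 1} n^{-2}\operatorname{Var}\{\log(L_n/L_{n-1})\}<\infty .$$ Then the following are equivalent: (i) there is a constant $c>0$ such that, a.s. $[F_0^\infty]$, $\Pi^n(A)<\exp(-nc)$ for all large $n$; (ii) there is a constant $c>0$ such that $$\liminf_{N\to\infty}\frac1N\sum_{n=1}^N D(f_{n-1\,A},f_0)>c\qquad\text{a.s. } [F_0^\infty].$$
   Context: Let $X_1,X_2,\ldots$, taking values in $(\mathscr{X},\mathscr{B})$, be i.i.d. with fixed density $f_0$ (with respect to Lebesgue measure) and distribution $F_0$; $F_0^\infty$ is the infinite product measure, and all almost sure statements and variances refer to it. $\Omega$ is the space of density functions (with respect to Lebesgue measure) on $(\mathscr{X},\mathscr{B})$, and the prior $\Pi$ is a probability distribution on $\Omega$. Put $R_n(f)=\prod_{i=1}^n f(X_i)/f_0(X_i)$ (with $R_0\equiv 1$). The posterior is $$\Pi^n(A)=\frac{\int_A R_n(f)\,\Pi(df)}{\int R_n(f)\,\Pi(df)} .$$ With $L_n=\int_A R_n(f)\,\Pi(df)$, so $L_0=\Pi(A)$, the predictive density with posterior restricted and normalized to $A$ is $$f_{nA}(x)=\int f(x)\,\Pi_A^n(df)=\frac{\int_A f(x)R_n(f)\,\Pi(df)}{L_n},\qquad n\ge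 0,$$ and $f_{n-1\,A}$ denotes this density with $n$ replaced by $n-1$. It is understood that $A$ is such that this is well defined, i.e. $L_n>0$ a.s. for all $n\ge 0$. The Kullback–Leibler divergence is $D(f,f_0)=\int f_0\log(f_0/f)$. *)

theory Defs
  imports "HOL-Probability.Probability"
begin

definition densities :: "'a measure \<Rightarrow> ('a \<Rightarrow> real) set" where
  "densities M = {f \<in> borel_measurable M. (\<forall>x\<in>space M. 0 \<le> f x) \<and> (\<integral>\<^sup>+x. ennreal (f x) \<partial>M) = 1}"

(* A prior lives on a measurable space of densities on which (f, x) \<mapsto> f x is jointly measurable,
   as is needed for the integrals over f and for the predictive densities to make sense.
   The inclusion of space \<pi> in densities M cannot be an equality: for Lebesgue measure, no
   sigma-algebra on the set of all Borel densities makes evaluation jointly measurable (the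
   sections of a product-measurable function have bounded Borel rank). Choosing one measurable
   version per a.e.-class (e.g. by Lebesgue differentiation) represents every Borel prior on
   the L1 space of densities in this way. *)
definition density_prior :: "'a measure \<Rightarrow> ('a \<Rightarrow> real) measure \<Rightarrow> bool" where
  "density_prior M \<pi> \<longleftrightarrow> prob_space \<pi> \<and> space \<pi> \<subseteq> densities M \<and>
     (\<lambda>(f, x). f x) \<in> borel_measurable (\<pi> \<Otimes>\<^sub>M M)"

(* D(f, f0), the integral of f0 log (f0 / f), with values in [0, \<infinity>]. For densities the negative
   part of the integrand has integral at most 1, so the integral is \<infinity> exactly when f vanishes on
   a set of positive f0-probability (there log (f0 / 0) = \<infinity>, whereas ln 0 = 0 in HOL) or when
   the integrand is not integrable. *)
definition KL_div :: "'a measure \<Rightarrow> ('a \<Rightarrow> real) \<Rightarrow> ('a \<Rightarrow> real) \<Rightarrow> ereal" where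
  "KL_div M f f0 =
     (if (AE x in M. f x = 0 \<longrightarrow> f0 x = 0) \<and> integrable M (\<lambda>x. f0 x * ln (f0 x / f x))
      then ereal (\<integral>x. f0 x * ln (f0 x / f x) \<partial>M) else \<infinity>)"

definition KL_property :: "'a measure \<Rightarrow> ('a \<Rightarrow> real) measure \<Rightarrow> ('a \<Rightarrow> real) \<Rightarrow> bool" where
  "KL_property M \<pi> f0 \<longleftrightarrow> (\<forall>\<epsilon>>0. measure \<pi> {f \<in> space \<pi>. KL_div M f f0 < ereal \<epsilon>} > 0)"

(* The infinite product of F0. A point \<omega> is a data sequence, with \<omega> i = X_i for i \<ge> 1. *)
definition iid_law :: "'a measure \<Rightarrow> ('a \<Rightarrow> real) \<Rightarrow> (nat \<Rightarrow> 'a) measure" where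
  "iid_law M f0 = (\<Pi>\<^sub>M i\<in>{1..}. density M (\<lambda>x. ennreal (f0 x)))"

definition lik_ratio :: "('a \<Rightarrow> real) \<Rightarrow> nat \<Rightarrow> ('a \<Rightarrow> real) \<Rightarrow> (nat \<Rightarrow> 'a) \<Rightarrow> real" where
  "lik_ratio f0 n f \<omega> = (\<Prod>i=1..n. f (\<omega> i) / f0 (\<omega> i))"

(* L_n. The integrand is nonnegative and, by Tonelli, integrable for almost every \<omega>, so the
   default value 0 of the Bochner integral matters only on a null set; similarly for
   predictive below, for almost every \<omega> and then almost every x. *)
definition lik_mass ::
    "('a \<Rightarrow> real) measure \<Rightarrow> ('a \<Rightarrow> real) \<Rightarrow> ('a \<Rightarrow> real) set \<Rightarrow> nat \<Rightarrow> (nat \<Rightarrow> 'a) \<Rightarrow> real" where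
  "lik_mass \<pi> f0 A n \<omega> = (LINT f:A|\<pi>. lik_ratio f0 n f \<omega>)"

definition posterior ::
    "('a \<Rightarrow> real) measure \<Rightarrow> ('a \<Rightarrow> real) \<Rightarrow> nat \<Rightarrow> (nat \<Rightarrow> 'a) \<Rightarrow> ('a \<Rightarrow> real) set \<Rightarrow> real" where
  "posterior \<pi> f0 n \<omega> A = lik_mass \<pi> f0 A n \<omega> / (\<integral>f. lik_ratio f0 n f \<omega> \<partial>\<pi>)"

definition predictive ::
    "('a \<Rightarrow> real) measure \<Rightarrow> ('a \<Rightarrow> real) \<Rightarrow> ('a \<Rightarrow> real) set \<Rightarrow> nat \<Rightarrow> (nat \<Rightarrow> 'a) \<Rightarrow> 'a \<Rightarrow> real" where
  "predictive \<pi> f0 A n \<omega> x = (LINT f:A|\<pi>. f x * lik_ratio f0 n f \<omega>) / lik_mass \<pi> f0 A n \<omega>"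

end

theory Submission
  imports Defs
begin

text \<open>Write \<open>L n\<close> for the mass \<open>lik_mass \<pi> f0 A n\<close> and \<open>D n\<close> for the divergence of the predictive
  density at time \<open>n\<close> from \<open>f0\<close>. The ratio \<open>L (n + 1) / L n\<close> is the ratio of the predictive density
  to \<open>f0\<close> at the next observation (\<open>lik_mass_ratio\<close>). Since this observation is independent of the
  past and has density \<open>f0\<close>, the conditional mean of \<open>ln (L (n + 1) / L n)\<close> is \<open>- D n\<close>. So
  \<open>ln (L (n + 1) / L n) + D n\<close> are martingale differences, with second moments at most the variances
  in the summability hypothesis, and the strong law for martingale differences shows that
  \<open>(ln (L N) + D 0 + ... + D (N - 1)) / N\<close> tends to 0 almost surely (\<open>AE_log_lik_mass\<close>).
  Thus \<open>L N\<close> decays exponentially if and only if the mean divergences are bounded away from 0 in the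
  limit inferior.

  The posterior mass of \<open>A\<close> is \<open>L n\<close> divided by the evidence, the integral of the likelihood ratio
  over the whole prior. The evidence is subexponential in both directions: from above because its mean
  is at most 1 (\<open>evidence_upper\<close>), from below by the Kullback-Leibler property (\<open>evidence_lower\<close>,
  Schwartz's argument, based on the strong law for integrable i.i.d. variables). Hence the
  posterior mass and \<open>L n\<close> have the same exponential rate.

  Both strong laws are derived from Kolmogorov's maximal inequality and Kronecker's lemma. Conditional
  expectations are avoided: what is needed of independence is that replacing one observation by an
  independent copy preserves the law of the sequence (\<open>distr_update\<close>), combined with Fubini's
  theorem.\<close>

section \<open>Averages of real sequences\<close>

lemma Cesaro_mean:
  fixes x :: "nat \<Rightarrow> real"
  assumes "x \<longlonglongrightarrow> L"
  shows "(\<lambda>n. (\<Sum>i<n. x i) / real n) \<longlonglongrightarrow> L"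
proof -
  have "(\<lambda>n. (\<Sum>i<n. x i - L) / real n) \<longlonglongrightarrow> 0"
  proof (rule LIMSEQ_I)
    fix e :: real assume e: "0 < e"
    obtain N where N: "\<And>n. n \<ge> N \<Longrightarrow> \<bar>x n - L\<bar> < e / 2"
      using LIMSEQ_D[OF assms, of "e / 2"] e by auto
    define C where "C = (\<Sum>i<N. \<bar>x i - L\<bar>)"
    obtain K :: nat where K: "2 * C / e < real K" using reals_Archimedean2 by blast
    show "\<exists>no. \<forall>n\<ge>no. norm ((\<Sum>i<n. x i - L) / real n - 0) < e"
    proof (intro exI allI impI)
      fix n assume n: "n \<ge> max N (Suc K)"
      have split: "{..<n} = {..<N} \<union> {N..<n}" "{..<N} \<inter> {N..<n} = {}" using n by auto
      have "\<bar>\<Sum>i<n. x i - L\<bar> \<le> (\<Sum>i<n. \<bar>x i - L\<bar>)" by (rule sum_abs)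
      also have "\<dots> = C + (\<Sum>i=N..<n. \<bar>x i - L\<bar>)"
        unfolding C_def split(1) by (rule sum.union_disjoint) (use split in auto)
      also have "(\<Sum>i=N..<n. \<bar>x i - L\<bar>) \<le> (\<Sum>i=N..<n. e / 2)"
        by (intro sum_mono) (use N in \<open>auto intro: less_imp_le\<close>)
      also have "\<dots> \<le> real n * (e / 2)" using e by (simp add: mult_right_mono)
      finally have 1: "\<bar>\<Sum>i<n. x i - L\<bar> \<le> C + real n * (e / 2)" by simp
      have "C < real K * (e / 2)" using K e by (simp add: field_simps)
      also have "\<dots> \<le> real n * (e / 2)" using n e by (intro mult_right_mono) auto
      finally show "norm ((\<Sum>i<n. x i - L) / real n - 0) < e"
        using 1 n by (simp add: abs_div field_simps)
    qed
  qed
  then have "(\<lambda>n. (\<Sum>i<n. x i - L) / real n + L) \<longlonglongrightarrow> 0 + L" by (intro tendsto_intros)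
  moreover have "\<forall>\<^sub>F n in sequentially. (\<Sum>i<n. x i - L) / real n + L = (\<Sum>i<n. x i) / real n"
    using eventually_gt_at_top[of 0]
    by eventually_elim (simp add: sum_subtractf field_simps)
  ultimately show ?thesis by (simp add: tendsto_cong)
qed

text \<open>Summation by parts turns the average into the difference between the partial sums of the
  convergent series and their Cesaro means.\<close>

lemma Kronecker_lemma:
  fixes x :: "nat \<Rightarrow> real"
  assumes "convergent (\<lambda>n. \<Sum>i<n. x i / real (Suc i))"
  shows "(\<lambda>n. (\<Sum>i<n. x i) / real n) \<longlonglongrightarrow> 0"
proof -
  define s where "s n = (\<Sum>i<n. x i / real (Suc i))" for n
  obtain L where L: "s \<longlonglongrightarrow> L" using assms unfolding s_def convergent_def by auto
  have parts: "(\<Sum>i<n. x i) = real n * s n - (\<Sum>i<n. s i)" for n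
  proof (induction n)
    case (Suc n)
    have "x n = real (Suc n) * (s (Suc n) - s n)" by (simp add: s_def)
    then have "(\<Sum>i<Suc n. x i) = real n * s n - (\<Sum>i<n. s i) + real (Suc n) * (s (Suc n) - s n)"
      using Suc by simp
    also have "\<dots> = real (Suc n) * s (Suc n) - (\<Sum>i<Suc n. s i)"
      by (simp add: algebra_simps)
    finally show ?case .
  qed simp
  have "(\<lambda>n. s n - (\<Sum>i<n. s i) / real n) \<longlonglongrightarrow> L - L"
    by (intro tendsto_diff L Cesaro_mean)
  moreover have "\<forall>\<^sub>F n in sequentially. s n - (\<Sum>i<n. s i) / real n = (\<Sum>i<n. x i) / real n"
    using eventually_gt_at_top[of 0] by eventually_elim (simp add: parts field_simps)
  ultimately show ?thesis by (simp add: tendsto_cong)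
qed

section \<open>A strong law for martingale differences\<close>

lemma integrable_mult_of_squares:
  fixes f g :: "'a \<Rightarrow> real"
  assumes [measurable]: "f \<in> borel_measurable M" "g \<in> borel_measurable M"
    and "integrable M (\<lambda>x. (f x)\<^sup>2)" "integrable M (\<lambda>x. (g x)\<^sup>2)"
  shows "integrable M (\<lambda>x. f x * g x)"
proof (rule Bochner_Integration.integrable_bound)
  show "integrable M (\<lambda>x. (f x)\<^sup>2 + (g x)\<^sup>2)" using assms by auto
  have "\<bar>a * b\<bar> \<le> a\<^sup>2 + b\<^sup>2" for a b :: real
  proof -
    have "0 \<le> (\<bar>a\<bar> - \<bar>b\<bar>)\<^sup>2" "0 \<le> a\<^sup>2" "0 \<le> b\<^sup>2" by auto
    then have "2 * (\<bar>a\<bar> * \<bar>b\<bar>) \<le> a\<^sup>2 + b\<^sup>2" by (simp add: power2_diff)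
    moreover have "0 \<le> \<bar>a\<bar> * \<bar>b\<bar>" by simp
    ultimately show ?thesis unfolding abs_mult by linarith
  qed
  then show "AE x in M. norm (f x * g x) \<le> norm ((f x)\<^sup>2 + (g x)\<^sup>2)" by simp
qed simp

lemma integrable_add_square:
  fixes f g :: "'a \<Rightarrow> real"
  assumes [measurable]: "f \<in> borel_measurable M" "g \<in> borel_measurable M"
    and "integrable M (\<lambda>x. (f x)\<^sup>2)" "integrable M (\<lambda>x. (g x)\<^sup>2)"
  shows "integrable M (\<lambda>x. (f x + g x)\<^sup>2)"
proof -
  have "integrable M (\<lambda>x. (f x)\<^sup>2 + (g x)\<^sup>2 + 2 * (f x * g x))"
    using integrable_mult_of_squares[OF assms] assms by auto
  then show ?thesis by (simp add: power2_sum algebra_simps)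
qed

text \<open>The martingale property is stated as orthogonality to the square integrable functions of the
  past, which is what the maximal
  inequality needs and what Fubini's theorem gives.\<close>

locale martingale_differences = prob_space M for M :: "'a measure" +
  fixes F :: "nat \<Rightarrow> 'a measure" and \<xi> :: "nat \<Rightarrow> 'a \<Rightarrow> real"
  assumes subalg: "subalgebra M (F n)"
    and F_mono: "m \<le> n \<Longrightarrow> sets (F m) \<subseteq> sets (F n)"
    and adapted: "\<xi> n \<in> borel_measurable (F (Suc n))"
    and square_integrable: "integrable M (\<lambda>x. (\<xi> n x)\<^sup>2)"
    and orthogonal: "\<And>u. u \<in> borel_measurable (F n) \<Longrightarrow> integrable M (\<lambda>x. (u x)\<^sup>2) \<Longrightarrow>
           (\<integral>x. \<xi> n x * u x \<partial>M) = 0"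
begin

lemma borel_measurable_F_mono:
  "f \<in> borel_measurable (F m) \<Longrightarrow> m \<le> n \<Longrightarrow> f \<in> borel_measurable (F n)"
  using F_mono[of m n] subalg[of m] subalg[of n]
  by (auto simp: measurable_def subalgebra_def)

lemma borel_measurable_of_F: "f \<in> borel_measurable (F m) \<Longrightarrow> f \<in> borel_measurable M"
  by (rule measurable_from_subalg[OF subalg])

lemma partial_sum_measurable: "(\<lambda>x. \<Sum>i<k. \<xi> i x) \<in> borel_measurable (F k)"
  by (rule borel_measurable_sum) (rule borel_measurable_F_mono[OF adapted], simp)

text \<open>Kolmogorov's maximal inequality. The sum \<open>V\<close> stopped at the first passage of the level keeps
  the orthogonality of its increments, so its second moment is at most the sum of those of the
  differences, and the maximum exceeds the level only if the stopped sum does; Chebyshev's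
  inequality for the stopped sum thus suffices.\<close>

lemma maximal_inequality:
  assumes lam: "0 < c"
  shows "prob {x \<in> space M. \<exists>k\<le>n. c \<le> \<bar>\<Sum>i<k. \<xi> i x\<bar>} \<le> (\<Sum>i<n. expectation (\<lambda>x. (\<xi> i x)\<^sup>2)) / c\<^sup>2"
proof -
  define S where "S k x = (\<Sum>i<k. \<xi> i x)" for k x
  define I where "I k x = (if \<forall>j\<le>k. \<bar>S j x\<bar> < c then 1 else 0 :: real)" for k x
  define V where "V k x = (\<Sum>i<k. I i x * \<xi> i x)" for k x
  have S_meas: "S j \<in> borel_measurable (F k)" if "j \<le> k" for j k
    using borel_measurable_F_mono[OF partial_sum_measurable that] unfolding S_def .
  have I_meas: "I k \<in> borel_measurable (F k)" for k
  proof -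
    have [measurable]: "\<And>j. j \<in> {..k} \<Longrightarrow> S j \<in> borel_measurable (F k)" using S_meas by auto
    have "I k = (\<lambda>x. if \<forall>j\<in>{..k}. \<bar>S j x\<bar> < c then 1 else 0)" by (auto simp: I_def fun_eq_iff)
    also have "\<dots> \<in> borel_measurable (F k)" by measurable
    finally show ?thesis .
  qed
  have V_meas: "V k \<in> borel_measurable (F k)" for k
    unfolding V_def
    by (intro borel_measurable_sum borel_measurable_times borel_measurable_F_mono[OF adapted]
        borel_measurable_F_mono[OF I_meas]) auto
  note [measurable] = borel_measurable_of_F[OF I_meas] borel_measurable_of_F[OF V_meas]
    borel_measurable_of_F[OF adapted] borel_measurable_of_F[OF S_meas[OF order_refl]]
  have I01: "0 \<le> I k x" "I k x \<le> 1" "(I k x)\<^sup>2 \<le> 1" for k x by (auto simp: I_def)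
  have second_moment: "integrable M (\<lambda>x. (V k x)\<^sup>2) \<and>
      expectation (\<lambda>x. (V k x)\<^sup>2) \<le> (\<Sum>i<k. expectation (\<lambda>x. (\<xi> i x)\<^sup>2))" for k
  proof (induction k)
    case 0
    show ?case by (simp add: V_def)
  next
    case (Suc k)
    have sq_IV: "integrable M (\<lambda>x. (I k x * V k x)\<^sup>2)"
      by (rule Bochner_Integration.integrable_bound[OF conjunct1[OF Suc]])
         (use I01 in \<open>auto simp: power_mult_distrib intro!: mult_left_le_one_le\<close>)
    have sq_Ixi: "integrable M (\<lambda>x. (I k x * \<xi> k x)\<^sup>2)"
      by (rule Bochner_Integration.integrable_bound[OF square_integrable[of k]])
         (use I01 in \<open>auto simp: power_mult_distrib intro!: mult_left_le_one_le\<close>)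
    have le_xi: "expectation (\<lambda>x. (I k x * \<xi> k x)\<^sup>2) \<le> expectation (\<lambda>x. (\<xi> k x)\<^sup>2)"
      by (rule integral_mono[OF sq_Ixi square_integrable])
         (use I01 in \<open>auto simp: power_mult_distrib intro!: mult_left_le_one_le\<close>)
    have cross: "expectation (\<lambda>x. \<xi> k x * (I k x * V k x)) = 0"
      by (rule orthogonal[OF borel_measurable_times[OF I_meas V_meas] sq_IV])
    have cross_int: "integrable M (\<lambda>x. \<xi> k x * (I k x * V k x))"
      by (rule integrable_mult_of_squares[OF _ _ square_integrable sq_IV]) measurable
    have expand: "(V (Suc k) x)\<^sup>2 = (V k x)\<^sup>2 + 2 * (\<xi> k x * (I k x * V k x)) + (I k x * \<xi> k x)\<^sup>2" for x
      by (simp add: V_def power2_sum algebra_simps)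
    have "expectation (\<lambda>x. (V (Suc k) x)\<^sup>2) =
        expectation (\<lambda>x. (V k x)\<^sup>2) + expectation (\<lambda>x. (I k x * \<xi> k x)\<^sup>2)"
      unfolding expand using Suc cross cross_int sq_Ixi by simp
    with Suc le_xi have "expectation (\<lambda>x. (V (Suc k) x)\<^sup>2) \<le> (\<Sum>i<Suc k. expectation (\<lambda>x. (\<xi> i x)\<^sup>2))"
      by simp
    moreover have "integrable M (\<lambda>x. (V (Suc k) x)\<^sup>2)"
      unfolding expand using Suc cross_int sq_Ixi by auto
    ultimately show ?case by blast
  qed
  have stopped: "if \<exists>j\<le>k. c \<le> \<bar>S j x\<bar> then c \<le> \<bar>V k x\<bar> else V k x = S k x" for k x
  proof (induction k)
    case 0
    show ?case by (simp add: V_def S_def)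
  next
    case (Suc k)
    show ?case
    proof (cases "\<exists>j\<le>k. c \<le> \<bar>S j x\<bar>")
      case True
      then have "I k x = 0" by (auto simp: I_def)
      then have "V (Suc k) x = V k x" by (simp add: V_def)
      with True Suc show ?thesis by (auto intro: le_SucI)
    next
      case False
      then have "I k x = 1" by (auto simp: I_def)
      moreover have "V k x = S k x" using Suc False by auto
      ultimately have "V (Suc k) x = S (Suc k) x" by (simp add: V_def S_def)
      with False show ?thesis by (auto simp: le_Suc_eq)
    qed
  qed
  have "prob {x \<in> space M. \<exists>k\<le>n. c \<le> \<bar>\<Sum>i<k. \<xi> i x\<bar>} \<le> prob {x \<in> space M. \<bar>V n x\<bar> \<ge> c}"
  proof (rule finite_measure_mono)
    show "{x \<in> space M. \<exists>k\<le>n. c \<le> \<bar>\<Sum>i<k. \<xi> i x\<bar>} \<subseteq> {x \<in> space M. \<bar>V n x\<bar> \<ge> c}"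
      using stopped[of n] unfolding S_def by (smt (verit) Collect_mono)
  qed measurable
  also have "\<dots> \<le> expectation (\<lambda>x. (V n x)\<^sup>2) / c\<^sup>2"
    using second_moment[of n] lam by (intro second_moment_method) auto
  also have "\<dots> \<le> (\<Sum>i<n. expectation (\<lambda>x. (\<xi> i x)\<^sup>2)) / c\<^sup>2"
    using second_moment[of n] by (intro divide_right_mono) auto
  finally show ?thesis .
qed

lemma shift: "martingale_differences M (\<lambda>n. F (m + n)) (\<lambda>n. \<xi> (m + n))"
proof (rule martingale_differences.intro[OF prob_space_axioms], unfold_locales)
  show "sets (F (m + i)) \<subseteq> sets (F (m + j))" if "i \<le> j" for i j using that by (intro F_mono) auto
  show "\<xi> (m + n) \<in> borel_measurable (F (m + Suc n))" for n using adapted[of "m + n"] by simp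
qed (auto intro: subalg square_integrable orthogonal)

text \<open>The maximal inequality, applied to the differences from time \<open>m\<close> on, bounds the probability
  of an oscillation of size \<open>e\<close> after time \<open>m\<close> by a tail of a convergent series.\<close>

lemma AE_convergent_sum:
  assumes summable: "summable (\<lambda>n. expectation (\<lambda>x. (\<xi> n x)\<^sup>2))"
  shows "AE x in M. convergent (\<lambda>n. \<Sum>i<n. \<xi> i x)"
proof -
  define S where "S k x = (\<Sum>i<k. \<xi> i x)" for k x
  have [measurable]: "S k \<in> borel_measurable M" for k
    using borel_measurable_of_F[OF partial_sum_measurable] unfolding S_def .
  define v where "v n = expectation (\<lambda>x. (\<xi> n x)\<^sup>2)" for n
  have v0: "0 \<le> v n" for n by (simp add: v_def)
  have sv: "summable v" using summable by (simp add: v_def[abs_def])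
  have AE_tail: "AE x in M. \<exists>m. \<forall>k. \<bar>S (m + k) x - S m x\<bar> < e" if e: "0 < e" for e
  proof -
    define B where "B m n = {x \<in> space M. \<exists>k\<le>n. e \<le> \<bar>S (m + k) x - S m x\<bar>}" for m n
    have [measurable]: "B m n \<in> sets M" for m n unfolding B_def by measurable
    have B_le: "prob (B m n) \<le> (\<Sum>i. v (m + i)) / e\<^sup>2" for m n
    proof -
      interpret sh: martingale_differences M "\<lambda>n. F (m + n)" "\<lambda>n. \<xi> (m + n)" by (rule shift)
      have "S (m + k) x - S m x = (\<Sum>i<k. \<xi> (m + i) x)" for k x
        by (induction k) (auto simp: S_def)
      then have "prob (B m n) \<le> (\<Sum>i<n. v (m + i)) / e\<^sup>2"
        using sh.maximal_inequality[OF e, of n] by (simp add: B_def v_def)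
      also have "(\<Sum>i<n. v (m + i)) \<le> (\<Sum>i. v (m + i))"
        using sv v0 summable_ignore_initial_segment[OF sv, of m]
        by (intro sum_le_suminf) (auto simp: add.commute)
      finally show ?thesis by (simp add: divide_right_mono)
    qed
    define U where "U m = (\<Union>n. B m n)" for m
    have [measurable]: "U m \<in> sets M" for m unfolding U_def by measurable
    have U_le: "prob (U m) \<le> (\<Sum>i. v (m + i)) / e\<^sup>2" for m
    proof (rule LIMSEQ_le_const2)
      show "(\<lambda>n. prob (B m n)) \<longlonglongrightarrow> prob (U m)"
        unfolding U_def by (rule finite_Lim_measure_incseq) (auto simp: incseq_def B_def intro: order_trans)
    qed (use B_le in auto)
    have "(\<lambda>m. (\<Sum>i. v (m + i)) / e\<^sup>2) \<longlonglongrightarrow> 0 / e\<^sup>2"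
      using suminf_exist_split2[OF sv] by (intro tendsto_intros) (use e in \<open>auto simp: add.commute\<close>)
    then have lim: "(\<lambda>m. (\<Sum>i. v (m + i)) / e\<^sup>2) \<longlonglongrightarrow> 0" by simp
    have "prob (\<Inter>m. U m) \<le> 0"
    proof (rule LIMSEQ_le_const[OF lim], intro exI allI impI)
      fix m
      have "prob (\<Inter>m. U m) \<le> prob (U m)" by (intro finite_measure_mono) auto
      with U_le[of m] show "prob (\<Inter>m. U m) \<le> (\<Sum>i. v (m + i)) / e\<^sup>2" by simp
    qed
    then have "prob (\<Inter>m. U m) = 0" by (simp add: measure_le_0_iff)
    then have "(\<Inter>m. U m) \<in> null_sets M" by (auto simp: null_sets_def emeasure_eq_measure)
    then show ?thesis
    proof (rule AE_I', safe)
      fix x m assume "x \<in> space M" "\<nexists>m. \<forall>k. \<bar>S (m + k) x - S m x\<bar> < e"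
      then show "x \<in> U m" by (fastforce simp: U_def B_def not_less)
    qed
  qed
  have "AE x in M. \<forall>j::nat. \<exists>m. \<forall>k. \<bar>S (m + k) x - S m x\<bar> < 1 / real (Suc j)"
    unfolding AE_all_countable by (intro allI AE_tail) simp
  then show ?thesis
  proof eventually_elim
    case (elim x)
    have "Cauchy (\<lambda>n. S n x)"
    proof (rule metric_CauchyI)
      fix e :: real assume "0 < e"
      then obtain j where j: "1 / real (Suc j) < e / 2" using nat_approx_posE[of "e / 2"] by auto
      obtain m where m: "\<And>k. \<bar>S (m + k) x - S m x\<bar> < 1 / real (Suc j)" using elim by blast
      show "\<exists>N. \<forall>a\<ge>N. \<forall>b\<ge>N. dist (S a x) (S b x) < e"
      proof (intro exI allI impI)
        fix a b assume "m \<le> a" "m \<le> b"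
        then have "\<bar>S a x - S m x\<bar> < e / 2" "\<bar>S b x - S m x\<bar> < e / 2"
          using m[of "a - m"] m[of "b - m"] j by auto
        then show "dist (S a x) (S b x) < e" unfolding dist_real_def by linarith
      qed
    qed
    then show ?case by (simp add: Cauchy_convergent_iff S_def)
  qed
qed

lemma strong_law:
  assumes summable: "summable (\<lambda>n. expectation (\<lambda>x. (\<xi> n x)\<^sup>2) / (real (Suc n))\<^sup>2)"
  shows "AE x in M. (\<lambda>n. (\<Sum>i<n. \<xi> i x) / real n) \<longlonglongrightarrow> 0"
proof -
  interpret scaled: martingale_differences M F "\<lambda>n x. \<xi> n x / real (Suc n)"
  proof unfold_locales
    show "(\<lambda>x. \<xi> n x / real (Suc n)) \<in> borel_measurable (F (Suc n))" for n
      using adapted[of n] by simp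
    show "integrable M (\<lambda>x. (\<xi> n x / real (Suc n))\<^sup>2)" for n
      using square_integrable[of n] by (simp add: power_divide)
    show "expectation (\<lambda>x. \<xi> n x / real (Suc n) * u x) = 0"
      if "u \<in> borel_measurable (F n)" "integrable M (\<lambda>x. (u x)\<^sup>2)" for n u
      using orthogonal[OF that] by simp
  qed (auto intro: subalg dest: subsetD[OF F_mono])
  have "AE x in M. convergent (\<lambda>n. \<Sum>i<n. \<xi> i x / real (Suc i))"
    by (rule scaled.AE_convergent_sum) (use summable in \<open>simp add: power_divide\<close>)
  then show ?thesis by eventually_elim (rule Kronecker_lemma)
qed

end

section \<open>Independent observations\<close>

locale iid_sequence = prob_space Q for Q :: "'a measure"
begin

definition P :: "(nat \<Rightarrow> 'a) measure" where
  "P = (\<Pi>\<^sub>M i\<in>{1..}. Q)"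

definition past :: "nat \<Rightarrow> (nat \<Rightarrow> 'a) measure" where
  "past n = vimage_algebra (space P) (\<lambda>\<omega>. restrict \<omega> {1..n}) (\<Pi>\<^sub>M i\<in>{1..n}. Q)"

sublocale P: prob_space P
  unfolding P_def by (intro prob_space_PiM prob_space_axioms)

sublocale PQ: pair_prob_space P Q ..

lemma space_past [simp]: "space (past n) = space P"
  by (simp add: past_def)

lemma coordinate_measurable [measurable]: "(\<lambda>\<omega>. \<omega> (Suc n)) \<in> P \<rightarrow>\<^sub>M Q"
  unfolding P_def by (rule measurable_component_singleton) simp

lemma measurable_pastI:
  assumes g: "g \<in> borel_measurable (\<Pi>\<^sub>M i\<in>{1..n}. Q)"
    and eq: "\<And>\<omega>. \<omega> \<in> space P \<Longrightarrow> u \<omega> = g (restrict \<omega> {1..n})"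
  shows "u \<in> borel_measurable (past n)"
proof -
  have sp: "(\<lambda>\<omega>. restrict \<omega> {1..n}) \<in> space P \<rightarrow> space (\<Pi>\<^sub>M i\<in>{1..n}. Q)"
    by (auto simp: P_def space_PiM PiE_def Pi_def)
  have "(\<lambda>\<omega>. g (restrict \<omega> {1..n})) \<in> borel_measurable (past n)"
    unfolding past_def by (rule measurable_compose[OF measurable_vimage_algebra1[OF sp] g])
  then show ?thesis by (subst measurable_cong[OF eq]) simp_all
qed

lemma coordinate_past:
  assumes [measurable]: "v \<in> borel_measurable Q"
  shows "(\<lambda>\<omega>. v (\<omega> (Suc n))) \<in> borel_measurable (past (Suc n))"
proof (rule measurable_pastI)
  have [measurable]: "(\<lambda>\<omega>. \<omega> (Suc n)) \<in> (\<Pi>\<^sub>M i\<in>{1..Suc n}. Q) \<rightarrow>\<^sub>M Q"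
    by (rule measurable_component_singleton) simp
  show "(\<lambda>\<omega>. v (\<omega> (Suc n))) \<in> borel_measurable (\<Pi>\<^sub>M i\<in>{1..Suc n}. Q)" by measurable
qed simp

lemma subalgebra_past: "subalgebra P (past n)"
proof -
  have "(\<lambda>\<omega>. restrict \<omega> {1..n}) \<in> P \<rightarrow>\<^sub>M (\<Pi>\<^sub>M i\<in>{1..n}. Q)"
    unfolding P_def by (rule measurable_restrict_subset) auto
  then have "sets (past n) \<subseteq> sets P"
    unfolding past_def by (intro sets_image_in_sets) auto
  then show ?thesis by (simp add: subalgebra_def)
qed

lemma sets_past_mono:
  assumes "m \<le> n"
  shows "sets (past m) \<subseteq> sets (past n)"
proof -
  have sp: "(\<lambda>\<omega>. restrict \<omega> {1..n}) \<in> space P \<rightarrow> space (\<Pi>\<^sub>M i\<in>{1..n}. Q)"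
    by (auto simp: P_def space_PiM PiE_def Pi_def)
  have "(\<lambda>\<omega>. restrict (restrict \<omega> {1..n}) {1..m}) \<in> past n \<rightarrow>\<^sub>M (\<Pi>\<^sub>M i\<in>{1..m}. Q)"
    unfolding past_def
    by (rule measurable_compose[OF measurable_vimage_algebra1[OF sp] measurable_restrict_subset])
       (use assms in auto)
  then have "(\<lambda>\<omega>. restrict \<omega> {1..m}) \<in> past n \<rightarrow>\<^sub>M (\<Pi>\<^sub>M i\<in>{1..m}. Q)"
    using assms by (simp add: restrict_restrict min_absorb2 Int_absorb1)
  from sets_image_in_sets[OF _ this, of "space P"] show ?thesis
    unfolding past_def[of m] by simp
qed

lemma past_update:
  fixes u :: "(nat \<Rightarrow> 'a) \<Rightarrow> real"
  assumes u: "u \<in> borel_measurable (past n)" and \<omega>: "\<omega> \<in> space P" and x: "x \<in> space Q"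
  shows "u (fun_upd \<omega> (Suc n) x) = u \<omega>"
proof -
  have \<omega>': "fun_upd \<omega> (Suc n) x \<in> space P"
    using \<omega> x by (auto simp: P_def space_PiM PiE_def extensional_def)
  have sp: "(\<lambda>\<omega>. restrict \<omega> {1..n}) \<in> space P \<rightarrow> space (\<Pi>\<^sub>M i\<in>{1..n}. Q)"
    by (auto simp: P_def space_PiM PiE_def Pi_def)
  have "u -` {u \<omega>} \<inter> space (past n) \<in> sets (past n)"
    by (rule measurable_sets[OF u]) simp
  then obtain B where
    B: "u -` {u \<omega>} \<inter> space P = (\<lambda>\<omega>. restrict \<omega> {1..n}) -` B \<inter> space P"
    unfolding past_def by (auto simp: sets_vimage_algebra2[OF sp] simp del: One_nat_def)
  have "restrict (fun_upd \<omega> (Suc n) x) {1..n} = restrict \<omega> {1..n}" by (auto simp: restrict_def)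
  moreover have "\<omega> \<in> (\<lambda>\<omega>. restrict \<omega> {1..n}) -` B" using B \<omega> by blast
  ultimately have "fun_upd \<omega> (Suc n) x \<in> (\<lambda>\<omega>. restrict \<omega> {1..n}) -` B \<inter> space P" using \<omega>' by simp
  then show ?thesis unfolding B[symmetric] by simp
qed

lemma update_measurable [measurable]: "(\<lambda>(\<omega>, x). fun_upd \<omega> (Suc n) x) \<in> P \<Otimes>\<^sub>M Q \<rightarrow>\<^sub>M P"
proof -
  have "insert (Suc n) {1..} = {1..}" by auto
  then show ?thesis
    unfolding P_def using measurable_add_dim[of "Suc n" "{1..}" "\<lambda>_. Q"] by simp
qed

text \<open>Together with Fubini's theorem, this invariance replaces conditional expectations given the
  past: averaging over the inserted \<open>x\<close> is averaging over the next observation.\<close>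

lemma distr_update: "distr (P \<Otimes>\<^sub>M Q) P (\<lambda>(\<omega>, x). fun_upd \<omega> (Suc n) x) = P"
proof -
  interpret QP: pair_prob_space Q P ..
  have ins: "insert (Suc n) {1..} = {1..}" by auto
  have swap: "(\<lambda>(x, \<omega>). fun_upd \<omega> (Suc n) x) = (\<lambda>(\<omega>, x). fun_upd \<omega> (Suc n) x) \<circ> (\<lambda>(x, \<omega>). (\<omega>, x))"
    by (auto simp: fun_eq_iff)
  have "P = distr (Q \<Otimes>\<^sub>M P) P (\<lambda>(x, \<omega>). fun_upd \<omega> (Suc n) x)"
    using distr_pair_PiM_eq_PiM[of "{1..}" "\<lambda>_. Q" "Suc n"] prob_space_axioms
    unfolding P_def ins by simp
  also have "\<dots> = distr (distr (Q \<Otimes>\<^sub>M P) (P \<Otimes>\<^sub>M Q) (\<lambda>(x, \<omega>). (\<omega>, x))) P (\<lambda>(\<omega>, x). fun_upd \<omega> (Suc n) x)"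
    unfolding swap by (subst distr_distr) auto
  also have "distr (Q \<Otimes>\<^sub>M P) (P \<Otimes>\<^sub>M Q) (\<lambda>(x, \<omega>). (\<omega>, x)) = P \<Otimes>\<^sub>M Q"
    by (rule PQ.distr_pair_swap[symmetric])
  finally show ?thesis by (rule sym)
qed

text \<open>If \<open>h\<close> ignores observation \<open>Suc n\<close> of its first argument, as
  a function of the past does, then \<open>h (\<omega>, \<omega> (Suc n))\<close> has the law of \<open>h\<close> under the product measure, since composing
  it with the above replacement gives \<open>h\<close> back.\<close>

context
  fixes h :: "(nat \<Rightarrow> 'a) \<times> 'a \<Rightarrow> real" and n :: nat
  assumes h: "h \<in> borel_measurable (P \<Otimes>\<^sub>M Q)"
    and inv: "\<And>\<omega> x y. \<omega> \<in> space P \<Longrightarrow> x \<in> space Q \<Longrightarrow> y \<in> space Q \<Longrightarrow>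
      h (fun_upd \<omega> (Suc n) x, y) = h (\<omega>, y)"
begin

lemma next_measurable: "(\<lambda>\<omega>. h (\<omega>, \<omega> (Suc n))) \<in> borel_measurable P"
  using h by measurable

lemma next_update: "z \<in> space (P \<Otimes>\<^sub>M Q) \<Longrightarrow>
    (\<lambda>\<omega>. h (\<omega>, \<omega> (Suc n))) ((\<lambda>(\<omega>, x). fun_upd \<omega> (Suc n) x) z) = h z"
  using inv by (auto simp: space_pair_measure)

lemma integrable_next_iff: "integrable P (\<lambda>\<omega>. h (\<omega>, \<omega> (Suc n))) \<longleftrightarrow> integrable (P \<Otimes>\<^sub>M Q) h"
proof -
  have "integrable P (\<lambda>\<omega>. h (\<omega>, \<omega> (Suc n))) \<longleftrightarrow>
      integrable (P \<Otimes>\<^sub>M Q) (\<lambda>z. (\<lambda>\<omega>. h (\<omega>, \<omega> (Suc n))) ((\<lambda>(\<omega>, x). fun_upd \<omega> (Suc n) x) z))"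
    by (subst distr_update[of n, symmetric])
       (rule integrable_distr_eq[OF update_measurable next_measurable])
  also have "\<dots> \<longleftrightarrow> integrable (P \<Otimes>\<^sub>M Q) h"
    by (rule Bochner_Integration.integrable_cong[OF refl next_update])
  finally show ?thesis .
qed

lemma integral_next: "(\<integral>\<omega>. h (\<omega>, \<omega> (Suc n)) \<partial>P) = (\<integral>z. h z \<partial>(P \<Otimes>\<^sub>M Q))"
proof -
  have "(\<integral>\<omega>. h (\<omega>, \<omega> (Suc n)) \<partial>P) =
      (\<integral>z. (\<lambda>\<omega>. h (\<omega>, \<omega> (Suc n))) ((\<lambda>(\<omega>, x). fun_upd \<omega> (Suc n) x) z) \<partial>(P \<Otimes>\<^sub>M Q))"
    by (subst distr_update[of n, symmetric])
       (rule integral_distr[OF update_measurable next_measurable])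
  also have "\<dots> = (\<integral>z. h z \<partial>(P \<Otimes>\<^sub>M Q))"
    by (rule Bochner_Integration.integral_cong[OF refl next_update])
  finally show ?thesis .
qed

lemma nn_integral_next:
  "(\<integral>\<^sup>+\<omega>. ennreal (h (\<omega>, \<omega> (Suc n))) \<partial>P) = (\<integral>\<^sup>+\<omega>. \<integral>\<^sup>+x. ennreal (h (\<omega>, x)) \<partial>Q \<partial>P)"
proof -
  have "(\<integral>\<^sup>+\<omega>. ennreal (h (\<omega>, \<omega> (Suc n))) \<partial>P) =
      (\<integral>\<^sup>+z. ennreal ((\<lambda>\<omega>. h (\<omega>, \<omega> (Suc n))) ((\<lambda>(\<omega>, x). fun_upd \<omega> (Suc n) x) z)) \<partial>(P \<Otimes>\<^sub>M Q))"
    by (subst distr_update[of n, symmetric])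
       (rule nn_integral_distr[OF update_measurable], use next_measurable in simp)
  also have "\<dots> = (\<integral>\<^sup>+z. ennreal (h z) \<partial>(P \<Otimes>\<^sub>M Q))"
    by (rule nn_integral_cong) (simp only: next_update)
  also have "\<dots> = (\<integral>\<^sup>+\<omega>. \<integral>\<^sup>+x. ennreal (h (\<omega>, x)) \<partial>Q \<partial>P)"
    by (rule nn_integral_fst[symmetric]) (use h in simp)
  finally show ?thesis .
qed

lemma AE_next_pos:
  assumes "AE \<omega> in P. 0 < h (\<omega>, \<omega> (Suc n))"
  shows "AE \<omega> in P. AE x in Q. 0 < h (\<omega>, x)"
proof -
  note [measurable] = next_measurable
  have "(AE \<omega> in distr (P \<Otimes>\<^sub>M Q) P (\<lambda>(\<omega>, x). fun_upd \<omega> (Suc n) x). 0 < h (\<omega>, \<omega> (Suc n))) \<longleftrightarrow>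
      (AE z in P \<Otimes>\<^sub>M Q. 0 < (\<lambda>\<omega>. h (\<omega>, \<omega> (Suc n))) ((\<lambda>(\<omega>, x). fun_upd \<omega> (Suc n) x) z))"
    by (rule AE_distr_iff) measurable
  with assms have "AE z in P \<Otimes>\<^sub>M Q. 0 < (\<lambda>\<omega>. h (\<omega>, \<omega> (Suc n))) ((\<lambda>(\<omega>, x). fun_upd \<omega> (Suc n) x) z)"
    unfolding distr_update by blast
  then have "AE z in P \<Otimes>\<^sub>M Q. 0 < h z"
    using AE_space by eventually_elim (simp only: next_update)
  then show ?thesis using PQ.AE_pair by blast
qed

end

lemma martingale_differences_next:
  fixes h :: "nat \<Rightarrow> (nat \<Rightarrow> 'a) \<times> 'a \<Rightarrow> real"
  assumes h: "\<And>n. h n \<in> borel_measurable (P \<Otimes>\<^sub>M Q)"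
    and inv: "\<And>n \<omega> x y. \<omega> \<in> space P \<Longrightarrow> x \<in> space Q \<Longrightarrow> y \<in> space Q \<Longrightarrow>
      h n (fun_upd \<omega> (Suc n) x, y) = h n (\<omega>, y)"
    and adapted: "\<And>n. (\<lambda>\<omega>. h n (\<omega>, \<omega> (Suc n))) \<in> borel_measurable (past (Suc n))"
    and sq: "\<And>n. integrable (P \<Otimes>\<^sub>M Q) (\<lambda>z. (h n z)\<^sup>2)"
    and centered: "\<And>n. AE \<omega> in P. (\<integral>x. h n (\<omega>, x) \<partial>Q) = 0"
  shows "martingale_differences P past (\<lambda>n \<omega>. h n (\<omega>, \<omega> (Suc n)))"
proof unfold_locales
  fix n
  have sq': "integrable P (\<lambda>\<omega>. (h n (\<omega>, \<omega> (Suc n)))\<^sup>2)"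
    by (subst integrable_next_iff[of "\<lambda>z. (h n z)\<^sup>2"]) (use h inv sq in auto)
  then show "integrable P (\<lambda>\<omega>. (h n (\<omega>, \<omega> (Suc n)))\<^sup>2)" .
  fix u :: "(nat \<Rightarrow> 'a) \<Rightarrow> real"
  assume u: "u \<in> borel_measurable (past n)" and u2: "integrable P (\<lambda>\<omega>. (u \<omega>)\<^sup>2)"
  have [measurable]: "u \<in> borel_measurable P" by (rule measurable_from_subalg[OF subalgebra_past u])
  note [measurable] = h
  define g where "g z = h n z * u (fst z)" for z
  have g [measurable]: "g \<in> borel_measurable (P \<Otimes>\<^sub>M Q)" unfolding g_def by measurable
  have ginv: "g (fun_upd \<omega> (Suc n) x, y) = g (\<omega>, y)"
    if "\<omega> \<in> space P" "x \<in> space Q" "y \<in> space Q" for \<omega> x y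
    using that inv past_update[OF u] by (simp add: g_def)
  have "integrable P (\<lambda>\<omega>. h n (\<omega>, \<omega> (Suc n)) * u \<omega>)"
    by (rule integrable_mult_of_squares[OF _ _ sq' u2]) measurable
  then have "integrable P (\<lambda>\<omega>. g (\<omega>, \<omega> (Suc n)))" by (simp add: g_def)
  then have int: "integrable (P \<Otimes>\<^sub>M Q) g" using integrable_next_iff[OF g ginv] by simp
  have "(\<integral>\<omega>. h n (\<omega>, \<omega> (Suc n)) * u \<omega> \<partial>P) = (\<integral>\<omega>. g (\<omega>, \<omega> (Suc n)) \<partial>P)" by (simp add: g_def)
  also have "\<dots> = (\<integral>z. g z \<partial>(P \<Otimes>\<^sub>M Q))" by (rule integral_next[OF g ginv])
  also have "\<dots> = (\<integral>\<omega>. (\<integral>x. g (\<omega>, x) \<partial>Q) \<partial>P)" by (rule PQ.integral_fst'[OF int, symmetric])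
  also have "\<dots> = (\<integral>\<omega>. 0 \<partial>P)"
    by (rule integral_cong_AE) (use centered[of n] in \<open>auto simp: g_def\<close>)
  finally show "(\<integral>\<omega>. h n (\<omega>, \<omega> (Suc n)) * u \<omega> \<partial>P) = 0" by simp
qed (use subalgebra_past sets_past_mono adapted in auto)

end

text \<open>The terms vanish until the index passes \<open>a\<close>, and the tail of the series of \<open>1 / k\<^sup>2\<close> is
  of order \<open>1 / a\<close>, so the sum is of order \<open>a\<close>. The negative term in the bound lets the induction
  telescope.\<close>

lemma truncated_square_sum:
  fixes a :: real
  assumes a: "0 \<le> a"
  shows "(\<Sum>i<n. if a \<le> real (Suc i) then a\<^sup>2 / (real (Suc i))\<^sup>2 else 0)
    \<le> (if a \<le> real n then 2 * a - a\<^sup>2 / real n else 0)"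
proof (induction n)
  case (Suc n)
  consider "real (Suc n) < a" | "real n < a" "a \<le> real (Suc n)" | "a \<le> real n" by linarith
  then show ?case
  proof cases
    case 1
    then show ?thesis using Suc by simp
  next
    case 2
    define b where "b = real (Suc n)"
    have b: "b \<noteq> 0" by (simp add: b_def)
    have "a\<^sup>2 / (real (Suc n))\<^sup>2 + a\<^sup>2 / real (Suc n) = a * (a / real (Suc n)) * (1 / real (Suc n) + 1)"
      unfolding b_def[symmetric] using b by (simp add: power2_eq_square field_simps)
    also have "\<dots> \<le> a * 1 * 2"
      using 2 a by (intro mult_mono) auto
    finally show ?thesis using Suc 2 by simp
  next
    case 3
    show ?thesis
    proof (cases "n = 0")
      case True
      then have "a = 0" using 3 a by simp
      then show ?thesis using Suc by simp
    next
      case False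
      have "1 / (real (Suc n))\<^sup>2 \<le> 1 / (real n * real (Suc n))"
        using False unfolding power2_eq_square by (intro divide_left_mono mult_right_mono) auto
      also have "\<dots> = 1 / real n - 1 / real (Suc n)" using False by (simp add: field_simps)
      finally have "a\<^sup>2 * (1 / (real (Suc n))\<^sup>2) \<le> a\<^sup>2 * (1 / real n - 1 / real (Suc n))"
        by (intro mult_left_mono) auto
      then show ?thesis using Suc 3 by (simp add: right_diff_distrib)
    qed
  qed
qed (use a in simp)

lemma exceedance_sum:
  fixes a :: real
  assumes a: "0 \<le> a"
  shows "(\<Sum>i<n. if real (Suc i) < a then 1 else 0 :: real) \<le> a"
proof -
  have "(\<Sum>i<n. if real (Suc i) < a then 1 else 0 :: real) \<le> min a (real n)"
    by (induction n) (use a in auto)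
  then show ?thesis by simp
qed

context iid_sequence
begin

text \<open>Kolmogorov's strong law. The values truncated at the level \<open>Suc i\<close> satisfy the second moment
  condition of the strong law for martingale differences, and only finitely many values are changed
  by the truncation.\<close>

lemma strong_law_iid:
  fixes w :: "'a \<Rightarrow> real"
  assumes w: "integrable Q w"
  shows "AE \<omega> in P. (\<lambda>n. (\<Sum>i<n. w (\<omega> (Suc i))) / real n) \<longlonglongrightarrow> (\<integral>x. w x \<partial>Q)"
proof -
  have [measurable]: "w \<in> borel_measurable Q" using w by simp
  define t where "t i x = (if \<bar>w x\<bar> \<le> real (Suc i) then w x else 0)" for i x
  have [measurable]: "t i \<in> borel_measurable Q" for i unfolding t_def by measurable
  have t_le: "\<bar>t i x\<bar> \<le> \<bar>w x\<bar>" for i x by (simp add: t_def)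
  have t_int [simp]: "integrable Q (t i)" for i
    by (rule Bochner_Integration.integrable_bound[OF w]) (use t_le in auto)
  have t2_int [simp]: "integrable Q (\<lambda>x. (t i x)\<^sup>2)" for i
    by (rule integrable_const_bound[of _ "(real (Suc i))\<^sup>2"])
       (auto simp: t_def abs_le_square_iff[symmetric])
  define \<mu> where "\<mu> i = (\<integral>x. t i x \<partial>Q)" for i
  have \<mu>_lim: "\<mu> \<longlonglongrightarrow> (\<integral>x. w x \<partial>Q)"
    unfolding \<mu>_def
  proof (rule integral_dominated_convergence[where w="\<lambda>x. \<bar>w x\<bar>"])
    show "AE x in Q. (\<lambda>i. t i x) \<longlonglongrightarrow> w x"
    proof (rule AE_I2, rule tendsto_eventually)
      fix x
      obtain K :: nat where "\<bar>w x\<bar> < real K" using reals_Archimedean2 by blast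
      then show "\<forall>\<^sub>F i in sequentially. t i x = w x"
        by (intro eventually_sequentiallyI[of K]) (auto simp: t_def)
    qed
  qed (use w t_le in auto)

  have var_le: "(\<integral>x. (t i x - \<mu> i)\<^sup>2 \<partial>Q) \<le> (\<integral>x. (t i x)\<^sup>2 \<partial>Q)" for i
    using variance_eq[of "t i"] by (simp add: \<mu>_def)
  have summable_sq: "summable (\<lambda>i. (\<integral>x. (t i x)\<^sup>2 \<partial>Q) / (real (Suc i))\<^sup>2)"
  proof (rule bounded_imp_summable)
    fix n
    have "(\<Sum>i\<le>n. (\<integral>x. (t i x)\<^sup>2 \<partial>Q) / (real (Suc i))\<^sup>2) =
        (\<integral>x. (\<Sum>i\<le>n. (t i x)\<^sup>2 / (real (Suc i))\<^sup>2) \<partial>Q)" by simp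
    also have "\<dots> \<le> (\<integral>x. 2 * \<bar>w x\<bar> \<partial>Q)"
    proof (rule integral_mono)
      fix x
      have "(\<Sum>i\<le>n. (t i x)\<^sup>2 / (real (Suc i))\<^sup>2) =
          (\<Sum>i<Suc n. if \<bar>w x\<bar> \<le> real (Suc i) then \<bar>w x\<bar>\<^sup>2 / (real (Suc i))\<^sup>2 else 0)"
        unfolding lessThan_Suc_atMost by (rule sum.cong) (auto simp: t_def)
      also have "\<dots> \<le> (if \<bar>w x\<bar> \<le> real (Suc n) then 2 * \<bar>w x\<bar> - \<bar>w x\<bar>\<^sup>2 / real (Suc n) else 0)"
        by (rule truncated_square_sum) simp
      also have "\<dots> \<le> 2 * \<bar>w x\<bar>" by simp
      finally show "(\<Sum>i\<le>n. (t i x)\<^sup>2 / (real (Suc i))\<^sup>2) \<le> 2 * \<bar>w x\<bar>" .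
    qed (use w in auto)
    finally show "(\<Sum>i\<le>n. (\<integral>x. (t i x)\<^sup>2 \<partial>Q) / (real (Suc i))\<^sup>2) \<le> (\<integral>x. 2 * \<bar>w x\<bar> \<partial>Q)" .
  qed simp

  define h where "h i z = t i (snd z) - \<mu> i" for i and z :: "(nat \<Rightarrow> 'a) \<times> 'a"
  have h_meas [measurable]: "h i \<in> borel_measurable (P \<Otimes>\<^sub>M Q)" for i unfolding h_def by measurable
  have h2: "integrable (P \<Otimes>\<^sub>M Q) (\<lambda>z. (h i z)\<^sup>2)" for i
  proof (rule PQ.P.integrable_const_bound[of _ "(real (Suc i) + \<bar>\<mu> i\<bar>)\<^sup>2"])
    have "\<bar>h i z\<bar> \<le> \<bar>real (Suc i) + \<bar>\<mu> i\<bar>\<bar>" for z by (auto simp: h_def t_def)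
    then have "(h i z)\<^sup>2 \<le> (real (Suc i) + \<bar>\<mu> i\<bar>)\<^sup>2" for z by (rule abs_le_square_iff[THEN iffD1])
    then show "AE z in P \<Otimes>\<^sub>M Q. norm ((h i z)\<^sup>2) \<le> (real (Suc i) + \<bar>\<mu> i\<bar>)\<^sup>2"
      by (intro AE_I2) (simp del: of_nat_Suc)
  qed measurable
  interpret D: martingale_differences P past "\<lambda>n \<omega>. h n (\<omega>, \<omega> (Suc n))"
  proof (rule martingale_differences_next)
    show "(\<lambda>\<omega>. h n (\<omega>, \<omega> (Suc n))) \<in> borel_measurable (past (Suc n))" for n
      unfolding h_def snd_conv by (rule coordinate_past) measurable
    show "AE \<omega> in P. (\<integral>x. h n (\<omega>, x) \<partial>Q) = 0" for n
      by (simp add: h_def \<mu>_def prob_space)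
  qed (use h_meas h2 in \<open>simp_all add: h_def\<close>)
  have second_moment: "(\<integral>\<omega>. (h i (\<omega>, \<omega> (Suc i)))\<^sup>2 \<partial>P) \<le> (\<integral>x. (t i x)\<^sup>2 \<partial>Q)" for i
  proof -
    have "(\<integral>\<omega>. (h i (\<omega>, \<omega> (Suc i)))\<^sup>2 \<partial>P) = (\<integral>z. (h i z)\<^sup>2 \<partial>(P \<Otimes>\<^sub>M Q))"
      by (rule integral_next[where h="\<lambda>z. (h i z)\<^sup>2"]) (auto simp: h_def)
    also have "\<dots> = (\<integral>\<omega>. (\<integral>x. (h i (\<omega>, x))\<^sup>2 \<partial>Q) \<partial>P)"
      by (rule PQ.integral_fst'[OF h2, symmetric])
    also have "\<dots> = (\<integral>x. (t i x - \<mu> i)\<^sup>2 \<partial>Q)" by (simp add: h_def P.prob_space)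
    finally show ?thesis using var_le[of i] by simp
  qed
  have "AE \<omega> in P. (\<lambda>n. (\<Sum>i<n. h i (\<omega>, \<omega> (Suc i))) / real n) \<longlonglongrightarrow> 0"
  proof (rule D.strong_law, rule summable_comparison_test[OF _ summable_sq], intro exI allI impI)
    fix n
    show "norm ((\<integral>\<omega>. (h n (\<omega>, \<omega> (Suc n)))\<^sup>2 \<partial>P) / (real (Suc n))\<^sup>2)
        \<le> (\<integral>x. (t n x)\<^sup>2 \<partial>Q) / (real (Suc n))\<^sup>2"
      using second_moment[of n] by (simp add: divide_right_mono)
  qed
  then have truncated: "AE \<omega> in P. (\<lambda>n. (\<Sum>i<n. t i (\<omega> (Suc i)) - \<mu> i) / real n) \<longlonglongrightarrow> 0"
    by (simp add: h_def)

  define B where "B i = {\<omega> \<in> space P. real (Suc i) < \<bar>w (\<omega> (Suc i))\<bar>}" for i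
  have [measurable]: "B i \<in> sets P" for i unfolding B_def by measurable
  define e where "e i x = (if real (Suc i) < \<bar>w x\<bar> then 1 else 0 :: real)" for i x
  have [measurable]: "e i \<in> borel_measurable Q" for i unfolding e_def by measurable
  have e_int [simp]: "integrable Q (e i)" for i
    by (rule integrable_const_bound[of _ 1]) (auto simp: e_def)
  have prob_B: "P.prob (B i) = (\<integral>x. e i x \<partial>Q)" for i
  proof -
    have int_snd: "integrable (P \<Otimes>\<^sub>M Q) (\<lambda>z. e i (snd z))"
      by (rule PQ.P.integrable_const_bound[of _ 1]) (auto simp: e_def)
    have "P.prob (B i) = (\<integral>\<omega>. indicator (B i) \<omega> \<partial>P)" by simp
    also have "\<dots> = (\<integral>\<omega>. e i (snd (\<omega>, \<omega> (Suc i))) \<partial>P)"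
      by (rule Bochner_Integration.integral_cong) (auto simp: B_def e_def)
    also have "\<dots> = (\<integral>z. e i (snd z) \<partial>(P \<Otimes>\<^sub>M Q))"
      by (rule integral_next[where h="\<lambda>z. e i (snd z)"]) auto
    also have "\<dots> = (\<integral>x. e i x \<partial>Q)"
      by (subst PQ.integral_fst'[OF int_snd, symmetric]) (simp add: P.prob_space)
    finally show ?thesis .
  qed
  have "AE \<omega> in P. \<forall>\<^sub>F i in sequentially. \<omega> \<in> space P - B i"
  proof (rule borel_cantelli_AE1)
    show "summable (\<lambda>i. P.prob (B i))"
    proof (rule bounded_imp_summable)
      fix n
      have "(\<Sum>i\<le>n. P.prob (B i)) = (\<integral>x. (\<Sum>i\<le>n. e i x) \<partial>Q)" by (simp add: prob_B)
      also have "\<dots> \<le> (\<integral>x. \<bar>w x\<bar> \<partial>Q)"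
      proof (rule integral_mono)
        show "(\<Sum>i\<le>n. e i x) \<le> \<bar>w x\<bar>" for x
          using exceedance_sum[of "\<bar>w x\<bar>" "Suc n"] by (simp add: e_def lessThan_Suc_atMost)
      qed (use w in auto)
      finally show "(\<Sum>i\<le>n. P.prob (B i)) \<le> (\<integral>x. \<bar>w x\<bar> \<partial>Q)" .
    qed simp
  qed (auto simp: P.emeasure_eq_measure)
  with truncated show ?thesis
  proof eventually_elim
    case (elim \<omega>)
    have "(\<lambda>i. w (\<omega> (Suc i)) - t i (\<omega> (Suc i))) \<longlonglongrightarrow> 0"
      by (rule tendsto_eventually) (use elim(2) in \<open>auto elim!: eventually_mono simp: B_def t_def\<close>)
    then have "(\<lambda>n. (\<Sum>i<n. w (\<omega> (Suc i)) - t i (\<omega> (Suc i))) / real n) \<longlonglongrightarrow> 0"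
      by (rule Cesaro_mean)
    from tendsto_add[OF tendsto_add[OF this elim(1)] Cesaro_mean[OF \<mu>_lim]]
    show ?case by (simp add: add_divide_distrib[symmetric] sum.distrib[symmetric])
  qed
qed

end

section \<open>The Bayesian model\<close>

locale density_model =
  fixes M :: "'a measure" and f0 :: "'a \<Rightarrow> real" and \<pi> :: "('a \<Rightarrow> real) measure"
  assumes f0_density: "f0 \<in> densities M"
    and prior: "density_prior M \<pi>"
begin

definition Q :: "'a measure" where
  "Q = density M (\<lambda>x. ennreal (f0 x))"

lemma f0_measurable_M [measurable]: "f0 \<in> borel_measurable M"
  using f0_density by (simp add: densities_def)

lemma f0_nonneg: "x \<in> space M \<Longrightarrow> 0 \<le> f0 x"
  using f0_density by (simp add: densities_def)

lemma sets_Q [measurable_cong, simp]: "sets Q = sets M"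
  by (simp add: Q_def)

lemma space_Q [simp]: "space Q = space M"
  by (simp add: Q_def)

sublocale iid_sequence Q
proof (intro iid_sequence.intro prob_spaceI)
  have "emeasure Q (space Q) = (\<integral>\<^sup>+x. ennreal (f0 x) * indicator (space M) x \<partial>M)"
    unfolding Q_def by (simp add: emeasure_density)
  also have "\<dots> = (\<integral>\<^sup>+x. ennreal (f0 x) \<partial>M)"
    by (rule nn_integral_cong) simp
  also have "\<dots> = 1" using f0_density by (simp add: densities_def)
  finally show "emeasure Q (space Q) = 1" .
qed

sublocale prior: prob_space \<pi>
  using prior by (simp add: density_prior_def)

sublocale P_prior: pair_prob_space P \<pi> ..

lemma P_eq_iid_law: "P = iid_law M f0"
  unfolding P_def unfolding iid_law_def Q_def ..

lemma prior_density: "f \<in> space \<pi> \<Longrightarrow> f \<in> densities M"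
  using prior by (auto simp: density_prior_def)

lemma prior_nonneg: "f \<in> space \<pi> \<Longrightarrow> x \<in> space M \<Longrightarrow> 0 \<le> f x"
  using prior_density by (auto simp: densities_def)

lemma prior_measurable: "f \<in> space \<pi> \<Longrightarrow> f \<in> borel_measurable M"
  using prior_density by (auto simp: densities_def)

lemma space_P_D: "\<omega> \<in> space P \<Longrightarrow> 1 \<le> i \<Longrightarrow> \<omega> i \<in> space M"
  by (auto simp: P_def space_PiM PiE_def Pi_def)

lemma evaluation_measurable:
  assumes a: "a \<in> N \<rightarrow>\<^sub>M \<pi>" and b: "b \<in> N \<rightarrow>\<^sub>M M"
  shows "(\<lambda>z. a z (b z)) \<in> borel_measurable N"
proof -
  have "(\<lambda>(f, x). f x) \<in> borel_measurable (\<pi> \<Otimes>\<^sub>M M)" using prior by (simp add: density_prior_def)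
  from measurable_compose[OF measurable_Pair[OF a b] this] show ?thesis by simp
qed

subsection \<open>Likelihood ratios and predictive densities\<close>

lemma lik_ratio_Suc:
  "lik_ratio f0 (Suc n) f \<omega> = lik_ratio f0 n f \<omega> * (f (\<omega> (Suc n)) / f0 (\<omega> (Suc n)))"
  by (simp add: lik_ratio_def)

lemma lik_ratio_cong:
  "(\<And>i. i \<in> {1..n} \<Longrightarrow> \<omega> i = \<omega>' i) \<Longrightarrow> lik_ratio f0 n f \<omega> = lik_ratio f0 n f \<omega>'"
  unfolding lik_ratio_def by (rule prod.cong) auto

lemma lik_ratio_nonneg: "f \<in> space \<pi> \<Longrightarrow> \<omega> \<in> space P \<Longrightarrow> 0 \<le> lik_ratio f0 n f \<omega>"
  unfolding lik_ratio_def
  by (rule prod_nonneg) (use space_P_D[of \<omega>] prior_nonneg f0_nonneg in auto)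

lemma lik_ratio_measurable:
  assumes a: "a \<in> N \<rightarrow>\<^sub>M \<pi>" and b: "b \<in> N \<rightarrow>\<^sub>M (\<Pi>\<^sub>M i\<in>I. Q)" and I: "{1..n} \<subseteq> I"
  shows "(\<lambda>z. lik_ratio f0 n (a z) (b z)) \<in> borel_measurable N"
  unfolding lik_ratio_def
proof (rule borel_measurable_prod)
  fix i assume "i \<in> {1..n}"
  then have "(\<lambda>z. b z i) \<in> N \<rightarrow>\<^sub>M Q"
    using I by (intro measurable_compose[OF b measurable_component_singleton]) auto
  then have bi [measurable]: "(\<lambda>z. b z i) \<in> N \<rightarrow>\<^sub>M M" by (simp cong: measurable_cong_sets)
  note [measurable] = evaluation_measurable[OF a bi]
  show "(\<lambda>z. a z (b z i) / f0 (b z i)) \<in> borel_measurable N" by measurable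
qed

lemma lik_ratio_measurable_P:
  "a \<in> N \<rightarrow>\<^sub>M \<pi> \<Longrightarrow> b \<in> N \<rightarrow>\<^sub>M P \<Longrightarrow> (\<lambda>z. lik_ratio f0 n (a z) (b z)) \<in> borel_measurable N"
  unfolding P_def by (rule lik_ratio_measurable) auto

lemma lik_mass_measurable:
  assumes A: "A \<in> sets \<pi>" and I: "{1..n} \<subseteq> I"
  shows "lik_mass \<pi> f0 A n \<in> borel_measurable (\<Pi>\<^sub>M i\<in>I. Q)"
proof -
  note [measurable] = A lik_ratio_measurable[OF _ _ I]
  show ?thesis unfolding lik_mass_def[abs_def] set_lebesgue_integral_def
    by (rule prior.borel_measurable_lebesgue_integral) measurable
qed

lemma predictive_measurable:
  assumes A: "A \<in> sets \<pi>" and I: "{1..n} \<subseteq> I"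
  shows "(\<lambda>(\<omega>, x). predictive \<pi> f0 A n \<omega> x) \<in> borel_measurable ((\<Pi>\<^sub>M i\<in>I. Q) \<Otimes>\<^sub>M Q)"
proof -
  note [measurable] = A lik_ratio_measurable[OF _ _ I] lik_mass_measurable[OF A I] evaluation_measurable
  have "(\<lambda>z. LINT f:A|\<pi>. f (snd z) * lik_ratio f0 n f (fst z))
      \<in> borel_measurable ((\<Pi>\<^sub>M i\<in>I. Q) \<Otimes>\<^sub>M Q)"
    unfolding set_lebesgue_integral_def
    by (rule prior.borel_measurable_lebesgue_integral) measurable
  then show ?thesis unfolding predictive_def split_beta' by measurable
qed

lemma lik_mass_cong:
  assumes "\<And>i. i \<in> {1..n} \<Longrightarrow> \<omega> i = \<omega>' i"
  shows "lik_mass \<pi> f0 A n \<omega> = lik_mass \<pi> f0 A n \<omega>'"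
  unfolding lik_mass_def using lik_ratio_cong[OF assms] by simp

lemma predictive_cong:
  assumes "\<And>i. i \<in> {1..n} \<Longrightarrow> \<omega> i = \<omega>' i"
  shows "predictive \<pi> f0 A n \<omega> = predictive \<pi> f0 A n \<omega>'"
proof -
  have "lik_ratio f0 n f \<omega> = lik_ratio f0 n f \<omega>'" for f by (rule lik_ratio_cong[OF assms])
  moreover have "lik_mass \<pi> f0 A n \<omega> = lik_mass \<pi> f0 A n \<omega>'" by (rule lik_mass_cong[OF assms])
  ultimately show ?thesis by (simp add: predictive_def fun_eq_iff)
qed

text \<open>Division by 0 does no harm here: when the mass at time \<open>n\<close> vanishes, both sides are 0.\<close>

lemma lik_mass_ratio:
  "lik_mass \<pi> f0 A (Suc n) \<omega> / lik_mass \<pi> f0 A n \<omega> =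
    predictive \<pi> f0 A n \<omega> (\<omega> (Suc n)) / f0 (\<omega> (Suc n))"
proof -
  have "lik_mass \<pi> f0 A (Suc n) \<omega> =
      (LINT f:A|\<pi>. f (\<omega> (Suc n)) * lik_ratio f0 n f \<omega> / f0 (\<omega> (Suc n)))"
    unfolding lik_mass_def lik_ratio_Suc by (simp add: mult.commute)
  also have "\<dots> = (LINT f:A|\<pi>. f (\<omega> (Suc n)) * lik_ratio f0 n f \<omega>) / f0 (\<omega> (Suc n))"
    by (rule set_integral_divide_zero)
  finally show ?thesis by (simp add: predictive_def)
qed

subsection \<open>The evidence\<close>

lemma nn_integral_density_ratio:
  assumes "f \<in> densities M"
  shows "(\<integral>\<^sup>+x. ennreal (f x / f0 x) \<partial>Q) \<le> 1"
proof -
  have [measurable]: "f \<in> borel_measurable M" using assms by (simp add: densities_def)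
  have "(\<integral>\<^sup>+x. ennreal (f x / f0 x) \<partial>Q) = (\<integral>\<^sup>+x. ennreal (f0 x) * ennreal (f x / f0 x) \<partial>M)"
    unfolding Q_def by (rule nn_integral_density) measurable
  also have "\<dots> \<le> (\<integral>\<^sup>+x. ennreal (f x) \<partial>M)"
  proof (rule nn_integral_mono)
    fix x assume x: "x \<in> space M"
    then have "0 \<le> f x" using assms by (simp add: densities_def)
    then show "ennreal (f0 x) * ennreal (f x / f0 x) \<le> ennreal (f x)"
      using f0_nonneg[OF x] by (cases "f0 x = 0") (auto simp: ennreal_mult[symmetric])
  qed
  also have "\<dots> = 1" using assms by (simp add: densities_def)
  finally show ?thesis .
qed

text \<open>The likelihood ratios form a nonnegative supermartingale under \<open>P\<close>; the mean may be less than
  1, because \<open>f\<close> may charge the set where \<open>f0\<close> vanishes.\<close>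

lemma nn_integral_lik_ratio:
  assumes f: "f \<in> space \<pi>"
  shows "(\<integral>\<^sup>+\<omega>. ennreal (lik_ratio f0 n f \<omega>) \<partial>P) \<le> 1"
proof (induction n)
  case 0
  show ?case by (simp add: lik_ratio_def P.emeasure_space_1)
next
  case (Suc n)
  have fM [measurable]: "f \<in> borel_measurable M" by (rule prior_measurable[OF f])
  have c: "(\<lambda>z. f) \<in> N \<rightarrow>\<^sub>M \<pi>" for N :: "'c measure" using f by simp
  note [measurable] = lik_ratio_measurable_P[OF c]
  define h where "h z = lik_ratio f0 n f (fst z) * (f (snd z) / f0 (snd z))"
    for z :: "(nat \<Rightarrow> 'a) \<times> 'a"
  have "(\<integral>\<^sup>+\<omega>. ennreal (lik_ratio f0 (Suc n) f \<omega>) \<partial>P) = (\<integral>\<^sup>+\<omega>. ennreal (h (\<omega>, \<omega> (Suc n))) \<partial>P)"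
    by (simp add: h_def lik_ratio_Suc)
  also have "\<dots> = (\<integral>\<^sup>+\<omega>. \<integral>\<^sup>+x. ennreal (h (\<omega>, x)) \<partial>Q \<partial>P)"
  proof (rule nn_integral_next)
    show "h \<in> borel_measurable (P \<Otimes>\<^sub>M Q)" unfolding h_def by measurable
    show "h (fun_upd \<omega> (Suc n) x, y) = h (\<omega>, y)" for \<omega> x y
      using lik_ratio_cong[of n "fun_upd \<omega> (Suc n) x" \<omega> f] by (simp add: h_def)
  qed
  also have "\<dots> \<le> (\<integral>\<^sup>+\<omega>. ennreal (lik_ratio f0 n f \<omega>) \<partial>P)"
  proof (rule nn_integral_mono)
    fix \<omega> assume \<omega>: "\<omega> \<in> space P"
    have "(\<integral>\<^sup>+x. ennreal (h (\<omega>, x)) \<partial>Q) =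
        (\<integral>\<^sup>+x. ennreal (lik_ratio f0 n f \<omega>) * ennreal (f x / f0 x) \<partial>Q)"
      unfolding h_def fst_conv snd_conv
      by (rule nn_integral_cong, rule ennreal_mult)
         (use lik_ratio_nonneg[OF f \<omega>] prior_nonneg[OF f] f0_nonneg in auto)
    also have "\<dots> = ennreal (lik_ratio f0 n f \<omega>) * (\<integral>\<^sup>+x. ennreal (f x / f0 x) \<partial>Q)"
      by (rule nn_integral_cmult) measurable
    also have "\<dots> \<le> ennreal (lik_ratio f0 n f \<omega>) * 1"
      by (intro mult_left_mono nn_integral_density_ratio prior_density f) simp
    finally show "(\<integral>\<^sup>+x. ennreal (h (\<omega>, x)) \<partial>Q) \<le> ennreal (lik_ratio f0 n f \<omega>)" by simp
  qed
  finally show ?case using Suc by simp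
qed

definition evidence :: "nat \<Rightarrow> (nat \<Rightarrow> 'a) \<Rightarrow> real" where
  "evidence n \<omega> = (\<integral>f. lik_ratio f0 n f \<omega> \<partial>\<pi>)"

lemma evidence_measurable [measurable]: "evidence n \<in> borel_measurable P"
proof -
  note [measurable] = lik_ratio_measurable_P
  show ?thesis unfolding evidence_def[abs_def]
    by (rule prior.borel_measurable_lebesgue_integral) measurable
qed

lemma nn_integral_evidence:
  "(\<integral>\<^sup>+\<omega>. \<integral>\<^sup>+f. ennreal (lik_ratio f0 n f \<omega>) \<partial>\<pi> \<partial>P) \<le> 1"
proof -
  note [measurable] = lik_ratio_measurable_P
  have "(\<integral>\<^sup>+\<omega>. \<integral>\<^sup>+f. ennreal (lik_ratio f0 n f \<omega>) \<partial>\<pi> \<partial>P) =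
      (\<integral>\<^sup>+f. \<integral>\<^sup>+\<omega>. ennreal (lik_ratio f0 n f \<omega>) \<partial>P \<partial>\<pi>)"
    by (rule P_prior.Fubini'[symmetric]) measurable
  also have "\<dots> \<le> (\<integral>\<^sup>+f. 1 \<partial>\<pi>)" by (rule nn_integral_mono) (rule nn_integral_lik_ratio)
  finally show ?thesis by (simp add: prior.emeasure_space_1)
qed

lemma AE_integrable_lik_ratio: "AE \<omega> in P. \<forall>n. integrable \<pi> (\<lambda>f. lik_ratio f0 n f \<omega>)"
  unfolding AE_all_countable
proof
  fix n
  note [measurable] = lik_ratio_measurable_P
  have "AE \<omega> in P. (\<integral>\<^sup>+f. ennreal (lik_ratio f0 n f \<omega>) \<partial>\<pi>) \<noteq> \<infinity>"
    by (rule nn_integral_noteq_infinite)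
       (use nn_integral_evidence[of n] in \<open>auto simp: top_unique\<close>)
  then show "AE \<omega> in P. integrable \<pi> (\<lambda>f. lik_ratio f0 n f \<omega>)"
    using AE_space
  proof eventually_elim
    case (elim \<omega>)
    then show ?case
      by (intro integrableI_nonneg) (auto intro: lik_ratio_nonneg simp: less_top)
  qed
qed

text \<open>The evidence has mean at most 1, so Markov's inequality and the Borel-Cantelli lemma exclude
  exponential growth.\<close>

lemma evidence_upper:
  assumes \<epsilon>: "0 < \<epsilon>"
  shows "AE \<omega> in P. \<forall>\<^sub>F n in sequentially. evidence n \<omega> < exp (real n * \<epsilon>)"
proof -
  have nonneg: "0 \<le> evidence n \<omega>" if "\<omega> \<in> space P" for n \<omega>
    unfolding evidence_def by (rule Bochner_Integration.integral_nonneg) (use lik_ratio_nonneg that in auto)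
  have nn: "(\<integral>\<^sup>+\<omega>. ennreal (evidence n \<omega>) \<partial>P) \<le> 1" for n
  proof -
    note [measurable] = lik_ratio_measurable_P
    have "(\<integral>\<^sup>+\<omega>. ennreal (evidence n \<omega>) \<partial>P) \<le> (\<integral>\<^sup>+\<omega>. \<integral>\<^sup>+f. ennreal (lik_ratio f0 n f \<omega>) \<partial>\<pi> \<partial>P)"
    proof (rule nn_integral_mono_AE, use AE_integrable_lik_ratio AE_space in eventually_elim)
      fix \<omega> assume "\<forall>n. integrable \<pi> (\<lambda>f. lik_ratio f0 n f \<omega>)" "\<omega> \<in> space P"
      then show "ennreal (evidence n \<omega>) \<le> (\<integral>\<^sup>+f. ennreal (lik_ratio f0 n f \<omega>) \<partial>\<pi>)"
        unfolding evidence_def by (subst nn_integral_eq_integral) (auto intro: lik_ratio_nonneg)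
    qed
    also note nn_integral_evidence
    finally show ?thesis .
  qed
  have int: "integrable P (evidence n)" for n
    by (rule integrableI_nonneg) (use nonneg le_less_trans[OF nn[of n] ennreal_one_less_top] in auto)
  have le1: "(\<integral>\<omega>. evidence n \<omega> \<partial>P) \<le> 1" for n
    using nn[of n] nonneg by (subst (asm) nn_integral_eq_integral[OF int]) auto
  define B where "B n = {\<omega> \<in> space P. exp (real n * \<epsilon>) \<le> evidence n \<omega>}" for n
  have [measurable]: "B n \<in> sets P" for n unfolding B_def by measurable
  have B_le: "P.prob (B n) \<le> exp (- \<epsilon>) ^ n" for n
  proof -
    have "P.prob (B n) \<le> (\<integral>\<omega>. evidence n \<omega> \<partial>P) / exp (real n * \<epsilon>)"
      unfolding B_def by (rule integral_Markov_inequality_measure[OF int]) (use nonneg in auto)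
    also have "\<dots> \<le> 1 / exp (real n * \<epsilon>)" using le1 by (intro divide_right_mono) auto
    also have "\<dots> = exp (- \<epsilon>) ^ n" by (simp add: exp_minus exp_of_nat_mult[symmetric] field_simps)
    finally show ?thesis .
  qed
  have "AE \<omega> in P. \<forall>\<^sub>F n in sequentially. \<omega> \<in> space P - B n"
  proof (rule borel_cantelli_AE1)
    show "summable (\<lambda>n. P.prob (B n))"
    proof (rule summable_comparison_test)
      show "summable (\<lambda>n. exp (- \<epsilon>) ^ n)" using \<epsilon> by (intro summable_geometric) simp
    qed (use B_le in auto)
  qed (auto simp: P.emeasure_eq_measure)
  then show ?thesis
    by eventually_elim (auto elim!: eventually_mono simp: B_def)
qed

lemma KL_div_lessD:
  assumes f: "f \<in> space \<pi>" and less: "KL_div M f f0 < ereal \<epsilon>"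
  shows "AE x in Q. 0 < f x" "integrable Q (\<lambda>x. ln (f0 x / f x))" "(\<integral>x. ln (f0 x / f x) \<partial>Q) < \<epsilon>"
proof -
  have [measurable]: "f \<in> borel_measurable M" by (rule prior_measurable[OF f])
  have fin: "AE x in M. f x = 0 \<longrightarrow> f0 x = 0" "integrable M (\<lambda>x. f0 x * ln (f0 x / f x))"
    using less unfolding KL_div_def by (auto split: if_splits)
  then have int: "(\<integral>x. f0 x * ln (f0 x / f x) \<partial>M) < \<epsilon>"
    using less by (simp add: KL_div_def)
  have "AE x in M. 0 < ennreal (f0 x) \<longrightarrow> 0 < f x"
    using fin(1) AE_space by eventually_elim (use prior_nonneg[OF f] in \<open>auto simp: less_le\<close>)
  then show "AE x in Q. 0 < f x" unfolding Q_def by (subst AE_density) auto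
  have nonneg: "AE x in M. 0 \<le> f0 x" using f0_nonneg by auto
  show "integrable Q (\<lambda>x. ln (f0 x / f x))"
    unfolding Q_def by (subst integrable_real_density) (use nonneg fin(2) in auto)
  show "(\<integral>x. ln (f0 x / f x) \<partial>Q) < \<epsilon>"
    unfolding Q_def by (subst integral_real_density) (use nonneg int in auto)
qed

lemma AE_f0_pos: "AE x in Q. 0 < f0 x"
  unfolding Q_def by (subst AE_density) auto

lemma AE_all_observations:
  assumes "AE x in Q. R x"
  shows "AE \<omega> in P. \<forall>i. R (\<omega> (Suc i))"
  unfolding AE_all_countable
proof
  fix i
  have "distr P Q (\<lambda>\<omega>. \<omega> (Suc i)) = Q"
    unfolding P_def by (rule distr_PiM_component) (use prob_space_axioms in auto)
  then have "AE x in distr P Q (\<lambda>\<omega>. \<omega> (Suc i)). R x" using assms by (simp only:)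
  then show "AE \<omega> in P. R (\<omega> (Suc i))" by (rule AE_distrD[OF coordinate_measurable])
qed

text \<open>By the strong law, the likelihood ratio of a density closer than \<open>\<epsilon>\<close> to \<open>f0\<close> decays more
  slowly than \<open>exp (- n \<epsilon>)\<close>.\<close>

lemma AE_lik_ratio_lower:
  assumes f: "f \<in> space \<pi>" and less: "KL_div M f f0 < ereal \<epsilon>"
  shows "AE \<omega> in P. \<forall>\<^sub>F n in sequentially. exp (- real n * \<epsilon>) < lik_ratio f0 n f \<omega>"
  using AE_all_observations[OF AE_f0_pos] AE_all_observations[OF KL_div_lessD(1)[OF f less]]
    strong_law_iid[OF KL_div_lessD(2)[OF f less]]
proof eventually_elim
  case (elim \<omega>)
  have "\<forall>\<^sub>F n in sequentially. (\<Sum>i<n. ln (f0 (\<omega> (Suc i)) / f (\<omega> (Suc i)))) / real n < \<epsilon>"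
    by (rule order_tendstoD(2)[OF elim(3) KL_div_lessD(3)[OF f less]])
  then show ?case using eventually_gt_at_top[of 0]
  proof eventually_elim
    case (elim n)
    have lr: "lik_ratio f0 n f \<omega> = exp (- (\<Sum>i<n. ln (f0 (\<omega> (Suc i)) / f (\<omega> (Suc i)))))"
      unfolding lik_ratio_def sum_negf[symmetric]
      using \<open>\<forall>i. 0 < f0 (\<omega> (Suc i))\<close> \<open>\<forall>i. 0 < f (\<omega> (Suc i))\<close>
      by (simp add: exp_sum prod.atLeast1_atMost_eq exp_minus)
    show ?case unfolding lr using elim by (simp add: field_simps)
  qed
qed

text \<open>Schwartz's lower bound. By Fubini's theorem, almost surely almost every density of a
  Kullback-Leibler neighbourhood eventually has likelihood ratio above \<open>exp (- n \<epsilon> / 2)\<close>, so that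
  the mass of those that have it at time \<open>n\<close> tends to the prior mass of the neighbourhood.\<close>

lemma evidence_lower:
  assumes KL: "KL_property M \<pi> f0" and \<epsilon>: "0 < \<epsilon>"
  shows "AE \<omega> in P. \<forall>\<^sub>F n in sequentially. exp (- real n * \<epsilon>) < evidence n \<omega>"
proof -
  define K where "K = {f \<in> space \<pi>. KL_div M f f0 < ereal (\<epsilon> / 2)}"
  have K_pos: "0 < measure \<pi> K" using KL \<epsilon> by (simp add: KL_property_def K_def)
  \<comment> \<open>The measure of a nonmeasurable set is 0.\<close>
  then have K [measurable]: "K \<in> sets \<pi>" using measure_notin_sets[of K \<pi>] by force
  note [measurable] = lik_ratio_measurable_P
  define good where "good n \<omega> f \<longleftrightarrow> f \<in> K \<longrightarrow> exp (- real n * (\<epsilon> / 2)) < lik_ratio f0 n f \<omega>" for n \<omega> f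
  have "AE f in \<pi>. AE \<omega> in P. \<forall>\<^sub>F n in sequentially. good n \<omega> f"
  proof (rule AE_I2)
    fix f assume "f \<in> space \<pi>"
    then show "AE \<omega> in P. \<forall>\<^sub>F n in sequentially. good n \<omega> f"
      using AE_lik_ratio_lower[of f "\<epsilon> / 2"] by (cases "f \<in> K") (auto simp: good_def K_def)
  qed
  then have "AE \<omega> in P. AE f in \<pi>. \<forall>\<^sub>F n in sequentially. good n \<omega> f"
    unfolding eventually_sequentially good_def
    by (subst P_prior.AE_commute) measurable
  with AE_integrable_lik_ratio AE_space show ?thesis
  proof eventually_elim
    case (elim \<omega>)
    note \<omega> [measurable] = elim(2)
    define G where "G n = {f \<in> K. exp (- real n * (\<epsilon> / 2)) < lik_ratio f0 n f \<omega>}" for n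
    have [measurable]: "G n \<in> sets \<pi>" for n
    proof -
      have "G n = {f \<in> space \<pi>. f \<in> K \<and> exp (- real n * (\<epsilon> / 2)) < lik_ratio f0 n f \<omega>}"
        using sets.sets_into_space[OF K] by (auto simp: G_def)
      also have "\<dots> \<in> sets \<pi>" by measurable
      finally show ?thesis .
    qed
    have "(\<lambda>n. \<integral>f. indicator (G n) f \<partial>\<pi>) \<longlonglongrightarrow> (\<integral>f. indicator K f \<partial>\<pi> :: real)"
    proof (rule integral_dominated_convergence[where w="\<lambda>_. 1"])
      show "AE f in \<pi>. (\<lambda>n. indicator (G n) f :: real) \<longlonglongrightarrow> indicator K f"
        using elim(3)
        by eventually_elim
           (auto intro!: tendsto_eventually elim!: eventually_mono simp: good_def G_def indicator_def)
    qed auto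
    then have "(\<lambda>n. measure \<pi> (G n)) \<longlonglongrightarrow> measure \<pi> K" by simp
    then have 1: "\<forall>\<^sub>F n in sequentially. measure \<pi> K / 2 < measure \<pi> (G n)"
      using K_pos by (intro order_tendstoD(1)) auto
    have "(\<lambda>n. exp (- (\<epsilon> / 2)) ^ n) \<longlonglongrightarrow> 0" using \<epsilon> by (intro LIMSEQ_realpow_zero) auto
    then have 2: "\<forall>\<^sub>F n in sequentially. exp (- (\<epsilon> / 2)) ^ n < measure \<pi> K / 2"
      using K_pos by (intro order_tendstoD(2)) auto
    from 1 2 show ?case
    proof eventually_elim
      case (elim n)
      have "exp (- real n * \<epsilon>) = exp (- real n * (\<epsilon> / 2)) * exp (- (\<epsilon> / 2)) ^ n"
        by (simp add: exp_of_nat_mult[symmetric] exp_add[symmetric] field_simps)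
      also have "\<dots> < exp (- real n * (\<epsilon> / 2)) * measure \<pi> (G n)"
        using elim by (intro mult_strict_left_mono) auto
      also have "\<dots> = (\<integral>f. exp (- real n * (\<epsilon> / 2)) * indicator (G n) f \<partial>\<pi>)" by simp
      also have "\<dots> \<le> evidence n \<omega>"
        unfolding evidence_def
      proof (rule integral_mono)
        show "exp (- real n * (\<epsilon> / 2)) * indicator (G n) f \<le> lik_ratio f0 n f \<omega>"
          if "f \<in> space \<pi>" for f
          using lik_ratio_nonneg[OF that \<omega>] by (auto simp: G_def indicator_def)
        show "integrable \<pi> (\<lambda>f. exp (- real n * (\<epsilon> / 2)) * indicator (G n) f)"
          by (intro integrable_mult_right integrable_real_indicator)
             (auto simp: prior.emeasure_eq_measure)
      qed (use \<open>\<forall>n. integrable \<pi> (\<lambda>f. lik_ratio f0 n f \<omega>)\<close> in auto)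
      finally show ?case .
    qed
  qed
qed

end

section \<open>The normalized predictive densities\<close>

lemma (in prob_space) second_moment_about_mean:
  fixes w :: "'a \<Rightarrow> real"
  assumes w: "integrable M w" and w2: "integrable M (\<lambda>x. (w x)\<^sup>2)"
  shows "(\<integral>x. (expectation w - w x)\<^sup>2 \<partial>M) \<le> (\<integral>x. (m - w x)\<^sup>2 \<partial>M)"
proof -
  have "(m - w x)\<^sup>2 = m\<^sup>2 - 2 * m * w x + (w x)\<^sup>2" for x m by (simp add: power2_diff)
  then have eq: "(\<integral>x. (m - w x)\<^sup>2 \<partial>M) = m\<^sup>2 - 2 * m * expectation w + expectation (\<lambda>x. (w x)\<^sup>2)" for m
    using w w2 by (simp add: prob_space)
  have "0 \<le> (m - expectation w)\<^sup>2" by simp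
  then show ?thesis unfolding eq by (simp add: power2_eq_square algebra_simps)
qed

context density_model
begin

definition log_loss :: "('a \<Rightarrow> real) set \<Rightarrow> nat \<Rightarrow> (nat \<Rightarrow> 'a) \<times> 'a \<Rightarrow> real" where
  "log_loss A n z = ln (f0 (snd z) / predictive \<pi> f0 A n (fst z) (snd z))"

text \<open>The divergence of the predictive density from \<open>f0\<close> as a real number: almost surely it is
  finite and equal to this integral (lemma \<open>AE_KL_div_predictive\<close>).\<close>

definition divergence :: "('a \<Rightarrow> real) set \<Rightarrow> nat \<Rightarrow> (nat \<Rightarrow> 'a) \<Rightarrow> real" where
  "divergence A n \<omega> = (\<integral>x. log_loss A n (\<omega>, x) \<partial>Q)"

lemma log_loss_measurable:
  assumes A: "A \<in> sets \<pi>" and I: "{1..n} \<subseteq> I"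
  shows "log_loss A n \<in> borel_measurable ((\<Pi>\<^sub>M i\<in>I. Q) \<Otimes>\<^sub>M Q)"
proof -
  note [measurable] = predictive_measurable[OF A I]
  show ?thesis unfolding log_loss_def[abs_def] by measurable
qed

lemma log_loss_measurable_P: "A \<in> sets \<pi> \<Longrightarrow> log_loss A n \<in> borel_measurable (P \<Otimes>\<^sub>M Q)"
  unfolding P_def by (rule log_loss_measurable) auto

lemma log_loss_cong:
  "(\<And>i. i \<in> {1..n} \<Longrightarrow> \<omega> i = \<omega>' i) \<Longrightarrow> log_loss A n (\<omega>, x) = log_loss A n (\<omega>', x)"
  using predictive_cong[of n \<omega> \<omega>' A] by (simp add: log_loss_def)

lemma log_loss_update: "log_loss A n (fun_upd \<omega> (Suc n) x, y) = log_loss A n (\<omega>, y)"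
  by (rule log_loss_cong) simp

lemma divergence_cong:
  "(\<And>i. i \<in> {1..n} \<Longrightarrow> \<omega> i = \<omega>' i) \<Longrightarrow> divergence A n \<omega> = divergence A n \<omega>'"
  using log_loss_cong[of n \<omega> \<omega>' A] by (simp add: divergence_def)

lemma divergence_past:
  assumes A: "A \<in> sets \<pi>"
  shows "divergence A n \<in> borel_measurable (past n)"
proof (rule measurable_pastI)
  show "divergence A n \<in> borel_measurable (\<Pi>\<^sub>M i\<in>{1..n}. Q)"
    unfolding divergence_def[abs_def]
    by (rule borel_measurable_lebesgue_integral) (use log_loss_measurable[OF A order_refl] in simp)
qed (rule divergence_cong, simp)

lemma lik_mass_past:
  assumes A: "A \<in> sets \<pi>"
  shows "lik_mass \<pi> f0 A n \<in> borel_measurable (past n)"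
  by (rule measurable_pastI[OF lik_mass_measurable[OF A order_refl]]) (rule lik_mass_cong, simp)

lemma log_loss_next:
  "log_loss A n (\<omega>, \<omega> (Suc n)) = - ln (lik_mass \<pi> f0 A (Suc n) \<omega> / lik_mass \<pi> f0 A n \<omega>)"
  unfolding lik_mass_ratio log_loss_def by (simp add: ln_div)

lemma KL_div_predictive:
  assumes A: "A \<in> sets \<pi>" and \<omega>: "\<omega> \<in> space P"
    and pos: "AE x in Q. 0 < predictive \<pi> f0 A n \<omega> x"
    and int: "integrable Q (\<lambda>x. log_loss A n (\<omega>, x))"
  shows "KL_div M (predictive \<pi> f0 A n \<omega>) f0 = ereal (divergence A n \<omega>)"
proof -
  have "AE x in M. 0 < ennreal (f0 x) \<longrightarrow> 0 < predictive \<pi> f0 A n \<omega> x"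
    using pos unfolding Q_def by (subst (asm) AE_density) auto
  then have supp: "AE x in M. predictive \<pi> f0 A n \<omega> x = 0 \<longrightarrow> f0 x = 0"
    using AE_space by eventually_elim (use f0_nonneg in \<open>auto simp: less_le\<close>)
  have meas: "(\<lambda>x. log_loss A n (\<omega>, x)) \<in> borel_measurable M"
    using measurable_compose[OF measurable_Pair1'[OF \<omega>] log_loss_measurable_P[OF A]]
    by (simp cong: measurable_cong_sets)
  have nonneg: "AE x in M. 0 \<le> f0 x" using f0_nonneg by auto
  have "integrable M (\<lambda>x. f0 x * log_loss A n (\<omega>, x))"
    using int unfolding Q_def by (subst (asm) integrable_real_density) (use nonneg meas in auto)
  moreover have "divergence A n \<omega> = (\<integral>x. f0 x * log_loss A n (\<omega>, x) \<partial>M)"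
    unfolding divergence_def Q_def by (subst integral_real_density) (use nonneg meas in auto)
  ultimately show ?thesis using supp by (simp add: KL_div_def log_loss_def)
qed

text \<open>The square integrable log-increment of \<open>lik_mass\<close> at time \<open>n\<close> has the law of minus the log
  loss under the product of the law of the past and \<open>Q\<close>. Hence almost every section of the log loss
  is integrable, which makes the divergences finite.\<close>

context
  fixes A :: "('a \<Rightarrow> real) set"
  assumes A: "A \<in> sets \<pi>"
    and pos: "\<And>n. AE \<omega> in P. 0 < lik_mass \<pi> f0 A n \<omega>"
    and sq: "\<And>n. integrable P (\<lambda>\<omega>. (ln (lik_mass \<pi> f0 A (Suc n) \<omega> / lik_mass \<pi> f0 A n \<omega>))\<^sup>2)"
begin

lemma log_loss_square_integrable: "integrable (P \<Otimes>\<^sub>M Q) (\<lambda>z. (log_loss A n z)\<^sup>2)"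
proof -
  note [measurable] = log_loss_measurable_P[OF A]
  have "integrable P (\<lambda>\<omega>. (log_loss A n (\<omega>, \<omega> (Suc n)))\<^sup>2)" using sq by (simp add: log_loss_next)
  then show ?thesis
    by (subst (asm) integrable_next_iff[where h="\<lambda>z. (log_loss A n z)\<^sup>2"])
       (auto simp: log_loss_update)
qed

lemma AE_log_loss_integrable:
  "AE \<omega> in P. integrable Q (\<lambda>x. log_loss A n (\<omega>, x)) \<and> integrable Q (\<lambda>x. (log_loss A n (\<omega>, x))\<^sup>2)"
  using PQ.AE_integrable_fst'[OF log_loss_square_integrable[of n]] AE_space
proof eventually_elim
  case (elim \<omega>)
  have "(\<lambda>x. log_loss A n (\<omega>, x)) \<in> borel_measurable Q"
    by (rule measurable_compose[OF measurable_Pair1'[OF elim(2)] log_loss_measurable_P[OF A]])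
  then show ?case using square_integrable_imp_integrable elim(1) by blast
qed

lemma AE_KL_div_predictive:
  "AE \<omega> in P. \<forall>n. KL_div M (predictive \<pi> f0 A n \<omega>) f0 = ereal (divergence A n \<omega>)"
  unfolding AE_all_countable
proof
  fix n
  define q where "q z = predictive \<pi> f0 A n (fst z) (snd z) / f0 (snd z)" for z
  have q_meas: "q \<in> borel_measurable (P \<Otimes>\<^sub>M Q)"
  proof -
    have [measurable]: "(\<lambda>(\<omega>, x). predictive \<pi> f0 A n \<omega> x) \<in> borel_measurable (P \<Otimes>\<^sub>M Q)"
      unfolding P_def by (rule predictive_measurable[OF A]) auto
    show ?thesis unfolding q_def by measurable
  qed
  have q_inv: "q (fun_upd \<omega> (Suc n) x, y) = q (\<omega>, y)" for \<omega> x y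
    using predictive_cong[of n "fun_upd \<omega> (Suc n) x" \<omega> A] by (simp add: q_def)
  have "AE \<omega> in P. 0 < q (\<omega>, \<omega> (Suc n))"
    using pos[of n] pos[of "Suc n"]
    by eventually_elim (simp add: q_def lik_mass_ratio[symmetric])
  then have "AE \<omega> in P. AE x in Q. 0 < q (\<omega>, x)" using AE_next_pos[OF q_meas q_inv] by blast
  with AE_log_loss_integrable[of n] AE_space
  show "AE \<omega> in P. KL_div M (predictive \<pi> f0 A n \<omega>) f0 = ereal (divergence A n \<omega>)"
  proof eventually_elim
    case (elim \<omega>)
    have "AE x in Q. 0 < predictive \<pi> f0 A n \<omega> x"
      using elim(3) AE_f0_pos
      by eventually_elim (auto simp: q_def zero_less_divide_iff)
    then show ?case using elim by (intro KL_div_predictive[OF A]) auto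
  qed
qed

text \<open>The conditional mean minimizes the conditional mean square, so that centering the log loss at
  its conditional instead of its unconditional mean does not increase its second moment.\<close>

lemma centered_log_loss_square:
  shows "integrable (P \<Otimes>\<^sub>M Q) (\<lambda>z. (divergence A n (fst z) - log_loss A n z)\<^sup>2)"
    and "(\<integral>z. (divergence A n (fst z) - log_loss A n z)\<^sup>2 \<partial>(P \<Otimes>\<^sub>M Q))
      \<le> P.variance (\<lambda>\<omega>. ln (lik_mass \<pi> f0 A (Suc n) \<omega> / lik_mass \<pi> f0 A n \<omega>))"
proof -
  define Y where "Y \<omega> = ln (lik_mass \<pi> f0 A (Suc n) \<omega> / lik_mass \<pi> f0 A n \<omega>)" for \<omega>
  define m where "m = - P.expectation Y"
  note [measurable] = log_loss_measurable_P[OF A]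
  have [measurable]: "divergence A n \<in> borel_measurable P"
    by (rule measurable_from_subalg[OF subalgebra_past divergence_past[OF A]])
  have m2: "integrable (P \<Otimes>\<^sub>M Q) (\<lambda>z. (m - log_loss A n z)\<^sup>2)"
    using integrable_add_square[of "\<lambda>_. m" "P \<Otimes>\<^sub>M Q" "\<lambda>z. - log_loss A n z"]
      log_loss_square_integrable[of n] by simp
  have "P.variance Y = (\<integral>\<omega>. (m - log_loss A n (\<omega>, \<omega> (Suc n)))\<^sup>2 \<partial>P)"
    by (simp add: m_def Y_def log_loss_next algebra_simps)
  also have "\<dots> = (\<integral>z. (m - log_loss A n z)\<^sup>2 \<partial>(P \<Otimes>\<^sub>M Q))"
    by (rule integral_next[where h="\<lambda>z. (m - log_loss A n z)\<^sup>2"])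
       (auto simp: log_loss_update)
  finally have var: "P.variance Y = (\<integral>z. (m - log_loss A n z)\<^sup>2 \<partial>(P \<Otimes>\<^sub>M Q))" .
  have "(\<integral>\<^sup>+z. ennreal ((divergence A n (fst z) - log_loss A n z)\<^sup>2) \<partial>(P \<Otimes>\<^sub>M Q)) =
      (\<integral>\<^sup>+\<omega>. \<integral>\<^sup>+x. ennreal ((divergence A n \<omega> - log_loss A n (\<omega>, x))\<^sup>2) \<partial>Q \<partial>P)"
    by (subst nn_integral_fst[symmetric]) auto
  also have "\<dots> \<le> (\<integral>\<^sup>+\<omega>. \<integral>\<^sup>+x. ennreal ((m - log_loss A n (\<omega>, x))\<^sup>2) \<partial>Q \<partial>P)"
  proof (rule nn_integral_mono_AE, use AE_log_loss_integrable[of n] in eventually_elim)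
    fix \<omega>
    assume *: "integrable Q (\<lambda>x. log_loss A n (\<omega>, x)) \<and> integrable Q (\<lambda>x. (log_loss A n (\<omega>, x))\<^sup>2)"
    have int: "integrable Q (\<lambda>x. (c - log_loss A n (\<omega>, x))\<^sup>2)" for c
      using integrable_add_square[of "\<lambda>_. c" Q "\<lambda>x. - log_loss A n (\<omega>, x)"] *
        borel_measurable_integrable[of Q "\<lambda>x. log_loss A n (\<omega>, x)"] by simp
    show "(\<integral>\<^sup>+x. ennreal ((divergence A n \<omega> - log_loss A n (\<omega>, x))\<^sup>2) \<partial>Q)
        \<le> (\<integral>\<^sup>+x. ennreal ((m - log_loss A n (\<omega>, x))\<^sup>2) \<partial>Q)"
      using second_moment_about_mean[of "\<lambda>x. log_loss A n (\<omega>, x)" m] *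
      by (simp add: nn_integral_eq_integral[OF int] divergence_def ennreal_leI)
  qed
  also have "\<dots> = (\<integral>\<^sup>+z. ennreal ((m - log_loss A n z)\<^sup>2) \<partial>(P \<Otimes>\<^sub>M Q))"
    by (subst nn_integral_fst[symmetric]) auto
  also have "\<dots> = ennreal (P.variance Y)"
    unfolding var by (rule nn_integral_eq_integral[OF m2]) simp
  finally have le: "(\<integral>\<^sup>+z. ennreal ((divergence A n (fst z) - log_loss A n z)\<^sup>2) \<partial>(P \<Otimes>\<^sub>M Q))
    \<le> ennreal (P.variance Y)" .
  show int: "integrable (P \<Otimes>\<^sub>M Q) (\<lambda>z. (divergence A n (fst z) - log_loss A n z)\<^sup>2)"
    by (rule integrableI_nonneg) (use le_less_trans[OF le ennreal_less_top] in auto)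
  have "(\<integral>z. (divergence A n (fst z) - log_loss A n z)\<^sup>2 \<partial>(P \<Otimes>\<^sub>M Q)) \<le> P.variance Y"
    using le by (subst (asm) nn_integral_eq_integral[OF int]) (auto simp: integral_nonneg)
  then show "(\<integral>z. (divergence A n (fst z) - log_loss A n z)\<^sup>2 \<partial>(P \<Otimes>\<^sub>M Q))
      \<le> P.variance (\<lambda>\<omega>. ln (lik_mass \<pi> f0 A (Suc n) \<omega> / lik_mass \<pi> f0 A n \<omega>))"
    unfolding Y_def[abs_def] .
qed

text \<open>The conditional mean of the log-increment of \<open>lik_mass\<close> given the first \<open>n\<close> observations is minus the
  divergence of the predictive density, and the logarithms telescope.\<close>

lemma AE_log_lik_mass:
  assumes summable: "summable (\<lambda>n. P.variance
    (\<lambda>\<omega>. ln (lik_mass \<pi> f0 A (Suc n) \<omega> / lik_mass \<pi> f0 A n \<omega>)) / (real (Suc n))\<^sup>2)"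
  shows "AE \<omega> in P. (\<lambda>N. (ln (lik_mass \<pi> f0 A N \<omega>) + (\<Sum>n<N. divergence A n \<omega>)) / real N) \<longlonglongrightarrow> 0"
proof -
  define h where "h n z = divergence A n (fst z) - log_loss A n z" for n z
  have h_next: "h n (\<omega>, \<omega> (Suc n)) =
      ln (lik_mass \<pi> f0 A (Suc n) \<omega> / lik_mass \<pi> f0 A n \<omega>) + divergence A n \<omega>" for n \<omega>
    by (simp add: h_def log_loss_next)
  have [measurable]: "divergence A n \<in> borel_measurable P" for n
    by (rule measurable_from_subalg[OF subalgebra_past divergence_past[OF A]])
  note [measurable] = log_loss_measurable_P[OF A]
  have h_meas [measurable]: "h n \<in> borel_measurable (P \<Otimes>\<^sub>M Q)" for n unfolding h_def by measurable
  have h_inv: "h n (fun_upd \<omega> (Suc n) x, y) = h n (\<omega>, y)" for n \<omega> x y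
    using divergence_cong[of n "fun_upd \<omega> (Suc n) x" \<omega> A] by (simp add: h_def log_loss_update)
  have h2: "integrable (P \<Otimes>\<^sub>M Q) (\<lambda>z. (h n z)\<^sup>2)" for n
    unfolding h_def by (rule centered_log_loss_square)
  have past_Suc: "f \<in> borel_measurable (past (Suc n))" if "f \<in> borel_measurable (past n)"
    for n and f :: "(nat \<Rightarrow> 'a) \<Rightarrow> real"
    using that sets_past_mono[of n "Suc n"] by (auto simp: measurable_def)
  interpret D: martingale_differences P past "\<lambda>n \<omega>. h n (\<omega>, \<omega> (Suc n))"
  proof (rule martingale_differences_next)
    fix n
    note [measurable] = lik_mass_past[OF A, of "Suc n"] past_Suc[OF lik_mass_past[OF A, of n]]
      past_Suc[OF divergence_past[OF A, of n]]
    show "(\<lambda>\<omega>. h n (\<omega>, \<omega> (Suc n))) \<in> borel_measurable (past (Suc n))"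
      unfolding h_next by measurable
    show "AE \<omega> in P. (\<integral>x. h n (\<omega>, x) \<partial>Q) = 0"
      using AE_log_loss_integrable[of n]
      by eventually_elim (simp add: h_def divergence_def prob_space[simplified])
  qed (use h_meas h_inv h2 in auto)
  have "AE \<omega> in P. (\<lambda>N. (\<Sum>n<N. h n (\<omega>, \<omega> (Suc n))) / real N) \<longlonglongrightarrow> 0"
  proof (rule D.strong_law, rule summable_comparison_test[OF _ summable], intro exI allI impI)
    fix n
    have "(\<integral>\<omega>. (h n (\<omega>, \<omega> (Suc n)))\<^sup>2 \<partial>P) = (\<integral>z. (h n z)\<^sup>2 \<partial>(P \<Otimes>\<^sub>M Q))"
      by (rule integral_next[where h="\<lambda>z. (h n z)\<^sup>2"]) (auto simp: h_inv)
    also have "\<dots> \<le> P.variance (\<lambda>\<omega>. ln (lik_mass \<pi> f0 A (Suc n) \<omega> / lik_mass \<pi> f0 A n \<omega>))"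
      unfolding h_def by (rule centered_log_loss_square)
    finally show "norm ((\<integral>\<omega>. (h n (\<omega>, \<omega> (Suc n)))\<^sup>2 \<partial>P) / (real (Suc n))\<^sup>2) \<le>
        P.variance (\<lambda>\<omega>. ln (lik_mass \<pi> f0 A (Suc n) \<omega> / lik_mass \<pi> f0 A n \<omega>)) / (real (Suc n))\<^sup>2"
      by (simp add: divide_right_mono)
  qed
  moreover have "AE \<omega> in P. \<forall>n. 0 < lik_mass \<pi> f0 A n \<omega>"
    using pos by (simp add: AE_all_countable)
  ultimately show ?thesis
  proof eventually_elim
    case (elim \<omega>)
    have telescope: "(\<Sum>n<N. h n (\<omega>, \<omega> (Suc n))) =
        ln (lik_mass \<pi> f0 A N \<omega>) - ln (lik_mass \<pi> f0 A 0 \<omega>) + (\<Sum>n<N. divergence A n \<omega>)" for N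
      unfolding h_next
      by (induction N) (use elim(2) in \<open>auto simp: ln_divide_pos\<close>)
    have "(\<lambda>N. ln (lik_mass \<pi> f0 A 0 \<omega>) / real N) \<longlonglongrightarrow> 0"
      by (rule tendsto_divide_0[OF tendsto_const
          filterlim_at_top_imp_at_infinity[OF filterlim_real_sequentially]])
    from tendsto_add[OF elim(1) this] show ?case
      by (simp add: telescope add_divide_distrib[symmetric])
  qed
qed

end

subsection \<open>The equivalence\<close>

text \<open>Since the evidence lies between \<open>exp (- n \<epsilon>)\<close> and \<open>exp (n \<epsilon>)\<close>, the posterior mass and
  \<open>lik_mass\<close> decay at the same exponential rate, and by the preceding averages this rate is the limit
  inferior of the mean divergence. Each of the two approximations is allowed to cost a quarter of the
  given constant \<open>c\<close>.\<close>

theorem exponential_decay_iff_divergence: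
  assumes A: "A \<in> sets \<pi>"
    and pos: "\<And>n. AE \<omega> in P. 0 < lik_mass \<pi> f0 A n \<omega>"
    and KL: "KL_property M \<pi> f0"
    and sq: "\<And>n. integrable P (\<lambda>\<omega>. (ln (lik_mass \<pi> f0 A (Suc n) \<omega> / lik_mass \<pi> f0 A n \<omega>))\<^sup>2)"
    and summable: "summable (\<lambda>n. P.variance
      (\<lambda>\<omega>. ln (lik_mass \<pi> f0 A (Suc n) \<omega> / lik_mass \<pi> f0 A n \<omega>)) / (real (Suc n))\<^sup>2)"
  shows "(\<exists>c>0. AE \<omega> in P. \<forall>\<^sub>F n in sequentially. posterior \<pi> f0 n \<omega> A < exp (- real n * c)) \<longleftrightarrow>
    (\<exists>c>0. AE \<omega> in P.
      liminf (\<lambda>N. (\<Sum>n=1..N. KL_div M (predictive \<pi> f0 A (n - 1) \<omega>) f0) / ereal (real N)) > ereal c)"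
    (is "(\<exists>c>0. AE \<omega> in P. ?decay c \<omega>) \<longleftrightarrow> (\<exists>c>0. AE \<omega> in P. ?separated c \<omega>)")
proof -
  define s where "s N \<omega> = (\<Sum>n<N. divergence A n \<omega>)" for N \<omega>
  define L where "L n \<omega> = lik_mass \<pi> f0 A n \<omega>" for n \<omega>
  have pos': "AE \<omega> in P. \<forall>n. 0 < L n \<omega>" using pos by (simp add: AE_all_countable L_def)
  have average: "AE \<omega> in P. (\<lambda>N. (ln (L N \<omega>) + s N \<omega>) / real N) \<longlonglongrightarrow> 0"
    using AE_log_lik_mass[OF A pos sq summable] by (simp add: s_def L_def)
  have mean: "AE \<omega> in P. \<forall>N>0. (\<Sum>n=1..N. KL_div M (predictive \<pi> f0 A (n - 1) \<omega>) f0) / ereal (real N)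
      = ereal (s N \<omega> / real N)"
    using AE_KL_div_predictive[OF A pos sq]
    by eventually_elim (simp add: sum.atLeast1_atMost_eq s_def)
  have posterior: "posterior \<pi> f0 n \<omega> A = L n \<omega> / evidence n \<omega>" for n \<omega>
    by (simp add: posterior_def evidence_def L_def)
  show ?thesis
  proof safe
    fix c :: real assume c: "0 < c" and decay: "AE \<omega> in P. ?decay c \<omega>"
    then have c4: "0 < c / 4" by simp
    have "AE \<omega> in P. ?separated (c / 4) \<omega>"
      using decay pos' average mean evidence_upper[OF c4] evidence_lower[OF KL c4]
    proof eventually_elim
      case (elim \<omega>)
      have "\<forall>\<^sub>F N in sequentially. - (c / 4) < (ln (L N \<omega>) + s N \<omega>) / real N"
        using c by (intro order_tendstoD(1)[OF elim(3)]) simp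
      then have "\<forall>\<^sub>F N in sequentially. ereal (c / 2) \<le>
          (\<Sum>n=1..N. KL_div M (predictive \<pi> f0 A (n - 1) \<omega>) f0) / ereal (real N)"
        using elim(1,5,6) eventually_gt_at_top[of 0]
      proof eventually_elim
        case (elim N)
        have ev: "0 < evidence N \<omega>" using elim(4) by (rule less_trans[OF exp_gt_zero])
        have "L N \<omega> < exp (- real N * c) * evidence N \<omega>"
          using elim(2) ev by (simp add: posterior field_simps)
        also have "\<dots> < exp (- real N * c) * exp (real N * (c / 4))"
          using elim(3) by (intro mult_strict_left_mono) auto
        also have "\<dots> = exp (- (real N * (3 * c / 4)))" by (simp add: exp_add[symmetric])
        finally have "ln (L N \<omega>) < ln (exp (- (real N * (3 * c / 4))))"
          using \<open>\<forall>n. 0 < L n \<omega>\<close> by (subst ln_less_cancel_iff) auto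
        then have "ln (L N \<omega>) < - (real N * (3 * c / 4))" by simp
        moreover have "- (c / 4) * real N < ln (L N \<omega>) + s N \<omega>"
          using elim(1,5) by (simp add: pos_less_divide_eq)
        ultimately have "real N * (c / 2) < s N \<omega>" by (simp add: algebra_simps)
        then have "c / 2 \<le> s N \<omega> / real N" using elim(5) by (simp add: field_simps)
        then show ?case using \<open>\<forall>N>0. _ = ereal (s N \<omega> / real N)\<close> elim(5) by simp
      qed
      then have "ereal (c / 2) \<le>
          liminf (\<lambda>N. (\<Sum>n=1..N. KL_div M (predictive \<pi> f0 A (n - 1) \<omega>) f0) / ereal (real N))"
        by (rule Liminf_bounded)
      moreover have "ereal (c / 4) < ereal (c / 2)" using c by simp
      ultimately show ?case by (rule less_le_trans[rotated])
    qed
    with c4 show "\<exists>c>0. AE \<omega> in P. ?separated c \<omega>" by blast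
  next
    fix c :: real assume c: "0 < c" and separated: "AE \<omega> in P. ?separated c \<omega>"
    then have c4: "0 < c / 4" by simp
    have "AE \<omega> in P. ?decay (c / 2) \<omega>"
      using separated pos' average mean evidence_lower[OF KL c4]
    proof eventually_elim
      case (elim \<omega>)
      have "\<forall>\<^sub>F N in sequentially. (ln (L N \<omega>) + s N \<omega>) / real N < c / 4"
        using c by (intro order_tendstoD(2)[OF elim(3)]) simp
      then show ?case
        using less_LiminfD[OF elim(1)] elim(5) eventually_gt_at_top[of 0]
      proof eventually_elim
        case (elim N)
        have "c < s N \<omega> / real N"
          using elim(2,4) \<open>\<forall>N>0. _ = ereal (s N \<omega> / real N)\<close> by simp
        then have "c * real N < s N \<omega>" using elim(4) by (simp add: pos_less_divide_eq)
        moreover have "ln (L N \<omega>) + s N \<omega> < c / 4 * real N"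
          using elim(1,4) by (simp add: pos_divide_less_eq)
        ultimately have "ln (L N \<omega>) < - (real N * (3 * c / 4))" by (simp add: algebra_simps)
        then have "exp (ln (L N \<omega>)) < exp (- (real N * (3 * c / 4)))" by simp
        then have "L N \<omega> < exp (- (real N * (3 * c / 4)))"
          using \<open>\<forall>n. 0 < L n \<omega>\<close> by simp
        also have "\<dots> = exp (- real N * (c / 2)) * exp (- real N * (c / 4))"
          by (simp add: exp_add[symmetric] field_simps)
        also have "\<dots> < exp (- real N * (c / 2)) * evidence N \<omega>"
          using elim(3) by (intro mult_strict_left_mono) auto
        finally have "L N \<omega> < exp (- real N * (c / 2)) * evidence N \<omega>" .
        moreover have "0 < evidence N \<omega>" using elim(3) by (rule less_trans[OF exp_gt_zero])
        ultimately show ?case by (simp add: posterior pos_divide_less_eq)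
      qed
    qed
    moreover have "0 < c / 2" using c by simp
    ultimately show "\<exists>c>0. AE \<omega> in P. ?decay c \<omega>" by blast
  qed
qed

end

theorem mainTheorem3:
  fixes S :: "'a::euclidean_space set"
    and f0 :: "'a \<Rightarrow> real"
    and \<pi> :: "('a \<Rightarrow> real) measure"
    and A :: "('a \<Rightarrow> real) set"
  defines "M \<equiv> restrict_space lborel S"
  defines "P \<equiv> iid_law M f0"
  assumes "S \<in> sets borel"
    and "f0 \<in> densities M"
    and "density_prior M \<pi>"
    and "A \<in> sets \<pi>"
    and "\<And>n. AE \<omega> in P. lik_mass \<pi> f0 A n \<omega> > 0"
    and "KL_property M \<pi> f0"
    and "\<And>n. integrable P (\<lambda>\<omega>. (ln (lik_mass \<pi> f0 A (Suc n) \<omega> / lik_mass \<pi> f0 A n \<omega>))\<^sup>2)"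
    and "summable (\<lambda>n. prob_space.variance P
           (\<lambda>\<omega>. ln (lik_mass \<pi> f0 A (Suc n) \<omega> / lik_mass \<pi> f0 A n \<omega>)) / (real (Suc n))\<^sup>2)"
  shows "(\<exists>c>0. AE \<omega> in P. \<forall>\<^sub>F n in sequentially. posterior \<pi> f0 n \<omega> A < exp (- real n * c)) \<longleftrightarrow>
    (\<exists>c>0. AE \<omega> in P.
      liminf (\<lambda>N. (\<Sum>n=1..N. KL_div M (predictive \<pi> f0 A (n - 1) \<omega>) f0) / ereal (real N)) > ereal c)"
proof -
  interpret model: density_model M f0 \<pi>
    by unfold_locales (rule assms)+
  have P: "model.P = P" by (simp add: P_def model.P_eq_iid_law)
  show ?thesis
    using model.exponential_decay_iff_divergence[unfolded P, OF assms(6-10)] .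
qed

end
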